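(* Let $G=(V,E,\mathbf{w},\boldsymbol{\mu})$ be a submodular hypergraph with $V=\{1,\dots,N\}$, let $p\ge1$ and $k\in\{1,\dots,N\}$. Let $(\lambda_k^{(p)},x_k)$ be the $k$-th eigenpair of $\triangle_p$ (i.e. $x_k$ is an eigenvector of $\triangle_p$ for the eigenvalue $\lambda_k^{(p)}$), and let $m_k$ be the number of strong nodal domains of $x_k$. Then $$\left(\frac1\tau\right)^{p-1}\left(\frac{h_{m_k}}{p}\right)^p\le\lambda_k^{(p)}\le\left(\min\{\zeta(E),k\}\right)^{p-1}h_k,$$ where $\tau=\max_{v\in V}d_v/\mu_v$ and $\zeta(E)=\max_{e\in E}|e|$. If moreover $G$ is homogeneous (i.e. $w_e(S)=1$ for all $e\in E$ and all $S\in2^e\setminus\{\emptyset,e\}$), then $$\left(\frac2\tau\right)^{p-1}\left(\frac{h_{m_k}}{p}\right)^p\le\lambda_k^{(p)}\le2^{p-1}h_k.$$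
   Context: Submodular hypergraph: $V=[N]=\{1,\dots,N\}$; $E\subseteq 2^V$ is a nonempty set of hyperedges; each vertex has a weight $\mu_v>0$; each $e\in E$ carries a scalar $\vartheta_e>0$ and a function $w_e:2^e\to[0,1]$ that is submodular ($w_e(S)+w_e(T)\ge w_e(S\cup T)+w_e(S\cap T)$), satisfies $w_e(\emptyset)=0$, is symmetric ($w_e(S)=w_e(e\setminus S)$), and is normalized so that $\max_{S\subseteq e}w_e(S)=1$; every $v\in e$ satisfies $w_e(\{v\})>0$. For $S\subseteq V$ put $w_e(S):=w_e(S\cap e)$. The degree is $d_v=\sum_{e\in E:\,v\in e}\vartheta_e$. $\mathrm{vol}(S)=\sum_{v\in S}\mu_v$, $\mathrm{vol}(\partial S)=\sum_{e\in E}\vartheta_e w_e(S)$, $c(S)=\mathrm{vol}(\partial S)/\min\{\mathrm{vol}(S),\mathrm{vol}(V\setminus S)\}$ for nonempty $S\subsetneq V$, with the convention $c(V)=0$. $P_k$ is the set of $k$-tuples $(S_1,\dots,S_k)$ of nonempty pairwise disjoint subsets of $V$, and the $k$-way Cheeger constant is $h_k=\min_{(S_1,\dots,S_k)\in P_k}\max_{i}c(S_i)$. Lovász extension: $\mathcal{B}_e=\{y\in\mathbb{R}^N: y(S)\le w_e(S)\ \forall S\subseteq V,\ y(V)=0\}$ with $y(S)=\sum_{v\in S}y_v$; $f_e(x)=\max_{y\in\mathcal{B}_e}\langle y,x\rangle$, with subdifferential $\nabla f_e(x)=\arg\max_{y\in\mathcal{B}_e}\langle y,x\rangle$ (a set).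 $p$-Laplacian (set-valued): $\triangle_p(x)=\sum_{e\in E}\vartheta_e f_e(x)^{p-1}\nabla f_e(x)$ for $p>1$ and $\triangle_1(x)=\sum_{e\in E}\vartheta_e\nabla f_e(x)$ (Minkowski sums); $Q_p(x)=\sum_{e\in E}\vartheta_e f_e(x)^p$. $U=\mathrm{diag}(\mu_1,\dots,\mu_N)$; $(\varphi_p(x))_v=|x_v|^{p-1}\mathrm{sgn}(x_v)$, where $\mathrm{sgn}(a)=\pm1$ for $\pm a>0$ and $\mathrm{sgn}(0)=[-1,1]$ (so for $p=1$, $\varphi_1(x)$ is the set of vectors with $v$-th entry in $\mathrm{sgn}(x_v)$). A pair $(\lambda,x)$ with $x\neq0$ is an eigenpair of $\triangle_p$ if $\triangle_p(x)\cap\lambda U\varphi_p(x)\neq\emptyset$. Variational eigenvalues: $\mathcal{S}_{p,\mu}=\{x\in\mathbb{R}^N:\sum_v\mu_v|x_v|^p=1\}$. For a closed symmetric $A\subset\mathbb{R}^N\setminus\{0\}$ the Krasnoselski genus $\gamma(A)$ is $0$ if $A=\emptyset$, otherwise the least $k\in\mathbb{Z}^+$ such that an odd continuous map $A\to\mathbb{R}^k\setminus\{0\}$ exists ($\infty$ if there is none). $\mathcal{F}_k(\mathcal{S}_{p,\mu})=\{A\subseteq\mathcal{S}_{p,\mu}: A=-A,\ A\text{ closed},\ \gamma(A)\ge k\}$ and $\lambda_k^{(p)}=\min_{A\in\mathcal{F}_k(\mathcal{S}_{p,\mu})}\max_{x\in A}Q_p(x)$, $k=1,\dots,N$; these are eigenvalues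 of $\triangle_p$. Strong nodal domains: for $A\subseteq V$, call $u,v\in A$ adjacent if some $e\in E$ contains both and $w_e(S)>0$ for every $S\subseteq e$ with $u\in S$, $v\notin S$; the connected components of $A$ are those of the resulting graph on $A$. The strong nodal domains of $x\in\mathbb{R}^N$ are the connected components of $\{v:x_v>0\}$ together with the connected components of $\{v:x_v<0\}$. *)

theory Defs
  imports "HOL-Analysis.Analysis" "HOL-Library.Set_Algebras"
begin

section \<open>Submodular hypergraphs\<close>

text \<open>The vertex set is the finite type \<open>'n\<close>, so that N = CARD('n) and vectors indexed by the
  vertices are elements of \<open>real ^ 'n\<close>. The values \<open>eweight G e S\<close> are only meaningful for
  an edge e and \<open>S \<subseteq> e\<close>.\<close>

record 'n hypergraph =
  edges :: "'n set set"
  escale :: "'n set \<Rightarrow> real"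
  eweight :: "'n set \<Rightarrow> 'n set \<Rightarrow> real"
  vweight :: "'n \<Rightarrow> real"

definition submodular_hypergraph :: "'n::finite hypergraph \<Rightarrow> bool" where
  "submodular_hypergraph G \<longleftrightarrow>
     edges G \<noteq> {} \<and>
     (\<forall>v. vweight G v > 0) \<and>
     (\<forall>e\<in>edges G.
        escale G e > 0 \<and>
        (\<forall>S\<subseteq>e. 0 \<le> eweight G e S \<and> eweight G e S \<le> 1) \<and>
        (\<forall>S\<subseteq>e. \<forall>T\<subseteq>e. eweight G e S + eweight G e T
           \<ge> eweight G e (S \<union> T) + eweight G e (S \<inter> T)) \<and>
        eweight G e {} = 0 \<and>
        (\<forall>S\<subseteq>e. eweight G e S = eweight G e (e - S)) \<and>
        Max (eweight G e ` Pow e) = 1 \<and>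
        (\<forall>v\<in>e. eweight G e {v} > 0))"

definition homogeneous :: "'n hypergraph \<Rightarrow> bool" where
  "homogeneous G \<longleftrightarrow> (\<forall>e\<in>edges G. \<forall>S\<in>Pow e - {{}, e}. eweight G e S = 1)"

definition cut_weight :: "'n hypergraph \<Rightarrow> 'n set \<Rightarrow> 'n set \<Rightarrow> real" where
  "cut_weight G e S = eweight G e (S \<inter> e)"

definition degree :: "'n hypergraph \<Rightarrow> 'n \<Rightarrow> real" where
  "degree G v = (\<Sum>e\<in>{e \<in> edges G. v \<in> e}. escale G e)"

definition max_degree_ratio :: "'n::finite hypergraph \<Rightarrow> real" where
  "max_degree_ratio G = Max (range (\<lambda>v. degree G v / vweight G v))"

definition max_edge_size :: "'n hypergraph \<Rightarrow> nat" where
  "max_edge_size G = Max (card ` edges G)"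


section \<open>Cheeger constants\<close>

definition vol :: "'n hypergraph \<Rightarrow> 'n set \<Rightarrow> real" where
  "vol G S = (\<Sum>v\<in>S. vweight G v)"

definition boundary_vol :: "'n hypergraph \<Rightarrow> 'n set \<Rightarrow> real" where
  "boundary_vol G S = (\<Sum>e\<in>edges G. escale G e * cut_weight G e S)"

definition cheeger_ratio :: "'n hypergraph \<Rightarrow> 'n set \<Rightarrow> real" where
  "cheeger_ratio G S =
     (if S = UNIV then 0 else boundary_vol G S / min (vol G S) (vol G (UNIV - S)))"

definition disjoint_tuples :: "nat \<Rightarrow> 'n set list set" where
  "disjoint_tuples k =
     {Ss. length Ss = k \<and> (\<forall>i<k. Ss ! i \<noteq> {}) \<and>
          (\<forall>i<k. \<forall>j<k. i \<noteq> j \<longrightarrow> Ss ! i \<inter> Ss ! j = {})}"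

definition cheeger_const :: "'n hypergraph \<Rightarrow> nat \<Rightarrow> real" where
  "cheeger_const G k =
     Min ((\<lambda>Ss. Max (cheeger_ratio G ` set Ss)) ` disjoint_tuples k)"


section \<open>Lovasz extension and p-Laplacian\<close>

definition base_polytope :: "'n::finite hypergraph \<Rightarrow> 'n set \<Rightarrow> (real ^ 'n) set" where
  "base_polytope G e =
     {y. (\<forall>S. (\<Sum>v\<in>S. y $ v) \<le> cut_weight G e S) \<and> (\<Sum>v\<in>UNIV. y $ v) = 0}"

text \<open>For an edge of a submodular hypergraph the base polytope is compact and nonempty, so the
  supremum below is a maximum.\<close>

definition lovasz_ext :: "'n::finite hypergraph \<Rightarrow> 'n set \<Rightarrow> real ^ 'n \<Rightarrow> real" where
  "lovasz_ext G e x = (SUP y\<in>base_polytope G e. y \<bullet> x)"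

definition lovasz_subdiff ::
  "'n::finite hypergraph \<Rightarrow> 'n set \<Rightarrow> real ^ 'n \<Rightarrow> (real ^ 'n) set" where
  "lovasz_subdiff G e x = {y. is_arg_max (\<lambda>y. y \<bullet> x) (\<lambda>y. y \<in> base_polytope G e) y}"

text \<open>The sums over edges are Minkowski sums of sets. The case p = 1 is separate because
  \<open>0 powr 0 = 0\<close>; the same applies to \<open>p_duality\<close>.\<close>

definition p_laplacian ::
  "'n::finite hypergraph \<Rightarrow> real \<Rightarrow> real ^ 'n \<Rightarrow> (real ^ 'n) set" where
  "p_laplacian G p x =
     (if p = 1
      then (\<Sum>e\<in>edges G. (\<lambda>y. escale G e *\<^sub>R y) ` lovasz_subdiff G e x)
      else (\<Sum>e\<in>edges G.
              (\<lambda>y. (escale G e * lovasz_ext G e x powr (p - 1)) *\<^sub>R y) ` lovasz_subdiff G e x))"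

definition energy :: "'n::finite hypergraph \<Rightarrow> real \<Rightarrow> real ^ 'n \<Rightarrow> real" where
  "energy G p x = (\<Sum>e\<in>edges G. escale G e * lovasz_ext G e x powr p)"

definition sgn_set :: "real \<Rightarrow> real set" where
  "sgn_set a = (if a > 0 then {1} else if a < 0 then {-1} else {-1..1})"

definition p_duality :: "real \<Rightarrow> real ^ 'n::finite \<Rightarrow> (real ^ 'n) set" where
  "p_duality p x =
     {z. \<forall>v. z $ v \<in> (if p = 1 then sgn_set (x $ v)
                       else (\<lambda>s. \<bar>x $ v\<bar> powr (p - 1) * s) ` sgn_set (x $ v))}"

definition eigenpair :: "'n::finite hypergraph \<Rightarrow> real \<Rightarrow> real \<Rightarrow> real ^ 'n \<Rightarrow> bool" where
  "eigenpair G p l x \<longleftrightarrow>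
     x \<noteq> 0 \<and>
     p_laplacian G p x \<inter> (\<lambda>z. l *\<^sub>R (\<chi> v. vweight G v * z $ v)) ` p_duality p x \<noteq> {}"


section \<open>Variational eigenvalues\<close>

definition p_sphere :: "'n::finite hypergraph \<Rightarrow> real \<Rightarrow> (real ^ 'n) set" where
  "p_sphere G p = {x. (\<Sum>v\<in>UNIV. vweight G v * \<bar>x $ v\<bar> powr p) = 1}"

text \<open>\<open>Euclidean_space k\<close> is k-dimensional real space as a topology on the functions
  \<open>nat \<Rightarrow> real\<close> vanishing from k on.\<close>

definition odd_map_exists :: "'a::real_normed_vector set \<Rightarrow> nat \<Rightarrow> bool" where
  "odd_map_exists A k \<longleftrightarrow>
     (\<exists>f. continuous_map (top_of_set A)
            (subtopology (Euclidean_space k) (topspace (Euclidean_space k) - {\<lambda>i. 0})) f \<and>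
          (\<forall>x\<in>A. f (- x) = - f x))"

text \<open>The infimum of the empty set of extended naturals is \<open>\<infinity>\<close>.\<close>

definition genus :: "'a::real_normed_vector set \<Rightarrow> enat" where
  "genus A = (if A = {} then 0 else Inf {enat k |k. k > 0 \<and> odd_map_exists A k})"

definition genus_sets :: "'n::finite hypergraph \<Rightarrow> real \<Rightarrow> nat \<Rightarrow> (real ^ 'n) set set" where
  "genus_sets G p k =
     {A. A \<subseteq> p_sphere G p \<and> A = uminus ` A \<and> closed A \<and> genus A \<ge> enat k}"

text \<open>The infimum and the suprema are attained for a submodular hypergraph, \<open>p \<ge> 1\<close> and \<open>1 \<le> k \<le> CARD('n)\<close>.\<close>

definition var_eigenvalue :: "'n::finite hypergraph \<Rightarrow> real \<Rightarrow> nat \<Rightarrow> real" where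
  "var_eigenvalue G p k = (INF A\<in>genus_sets G p k. SUP x\<in>A. energy G p x)"


section \<open>Strong nodal domains\<close>

definition strongly_adjacent :: "'n hypergraph \<Rightarrow> 'n \<Rightarrow> 'n \<Rightarrow> bool" where
  "strongly_adjacent G u v \<longleftrightarrow>
     (\<exists>e\<in>edges G. u \<in> e \<and> v \<in> e \<and>
        (\<forall>S\<subseteq>e. u \<in> S \<and> v \<notin> S \<longrightarrow> cut_weight G e S > 0))"

text \<open>Adjacency is symmetric in a submodular hypergraph, so the components of the graph on A
  are the classes of the reflexive transitive closure.\<close>

definition adj_components :: "'n hypergraph \<Rightarrow> 'n set \<Rightarrow> 'n set set" where
  "adj_components G A = A // {(u, v). u \<in> A \<and> v \<in> A \<and> strongly_adjacent G u v}\<^sup>*"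

definition strong_nodal_domains :: "'n::finite hypergraph \<Rightarrow> real ^ 'n \<Rightarrow> 'n set set" where
  "strong_nodal_domains G x = adj_components G {v. x $ v > 0} \<union> adj_components G {v. x $ v < 0}"

end

theory Submission
  imports "HOL-Homology.Invariance_of_Domain" Defs
begin

text \<open>Lower bound. The Lovasz extension of a cut function w is
  \<open>x \<mapsto> \<integral> w {v. x v > t} dt\<close>. Distinct nodal domains of the same sign are separated, inside
  every edge, by sets of weight zero, and such sets split w additively; hence the restriction of an
  eigenvector to a nodal domain A has Rayleigh quotient at most the eigenvalue. Integrating the
  boundary volume of the superlevel sets of this restriction against \<open>p t^(p - 1) dt\<close> and applying
  Hoelder's inequality gives a superlevel set S of A with small ratio of boundary volume to
  volume. At most one of these sets has more than half the total volume; the complement of the union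
  of the others can take its place in the definition of the Cheeger constant.

  Upper bound. The p-sphere of the span of the indicator functions of an optimal k-tuple has genus at
  least k by the Borsuk-Ulam theorem, and on it the energy is bounded by convexity. The Borsuk-Ulam
  theorem follows from the parity step \<open>Borsuk_odd_mapping_degree_step\<close> once an odd map of the
  sphere has been deformed into one that preserves the equator; an odd polynomial approximation
  perturbed by a generic odd linear map allows this.\<close>

text \<open>The general and the homogeneous bounds differ only in an estimate on a single edge, so
  each direction is proved once, with that estimate as the hypothesis \<open>local\<close>. In the
  lower bound an edge gets a height R with R^p at most \<kappa> times the sum of z^p over e. The
  maximum of z on e gives \<kappa> = 1; for homogeneous edges the p-th power mean of maximum and
  minimum gives \<kappa> = 1/2, hence 2/\<tau>. The factor p^p comes from the density p t^(p - 1),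
  and \<tau> from exchanging the sums over edges and vertices after Hoelder. In the upper bound the
  constant counts what an edge sees: at most min(|e|, k) disjoint sets meet e, and in the
  homogeneous case two values determine f_e. Restriction to a nodal domain works because the
  subgradients in the eigenvector equation remain maximizers, so the equation can be tested against
  the restricted vector. On the topological side, n coordinates must be kept from vanishing together
  on the equator of the n-sphere, which has dimension n - 1; this is why a generic perturbation
  suffices.\<close>

section \<open>The Borsuk-Ulam theorem\<close>

text \<open>The map \<open>\<Phi>\<close> in the proof sends the hyperplane \<open>u $ i = 1\<close> onto a set containing all c that
  must be avoided. It is the identity on the coordinates outside I, so that source and target have
  the same dimension and the image of the hyperplane is negligible.\<close>

lemma odd_avoid_zero_coordinate:
  fixes g :: "real^'n \<Rightarrow> real^'n" and I :: "'n set"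
  assumes diff: "\<And>x. g differentiable (at x)" and odd: "\<And>x. g (- x) = - g x"
    and i: "i \<in> I" and e: "e > 0"
  obtains c where "norm c < e"
    "\<And>x. \<lbrakk>norm x = 1; \<And>j. j \<notin> I \<Longrightarrow> x $ j = 0; x $ i \<noteq> 0\<rbrakk> \<Longrightarrow> \<exists>j\<in>I. (g x + x $ i *\<^sub>R c) $ j \<noteq> 0"
proof -
  define P where "P = (\<lambda>u::real^'n. (\<chi> j. if j \<in> I then u $ j else 0))"
  have P_nth: "P u $ j = (if j \<in> I then u $ j else 0)" for u j
    by (simp add: P_def)
  have linP: "linear P"
    by (rule linearI) (auto simp: vec_eq_iff P_nth)
  then have Pdiff: "P differentiable F" for F
    by (simp add: linear_imp_differentiable)
  define Z where "Z = {u::real^'n. axis i 1 \<bullet> u = 1}"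
  have "negligible Z"
    unfolding Z_def by (rule negligible_hyperplane) auto
  define \<Phi> where "\<Phi> = (\<lambda>u. - (norm (P u) *\<^sub>R P (g (inverse (norm (P u)) *\<^sub>R P u))) + (u - P u))"
  have PZ: "P u \<noteq> 0" if "u \<in> Z" for u
  proof -
    have "P u $ i = 1"
      using that i by (simp add: Z_def P_nth inner_axis inner_commute)
    then show ?thesis by auto
  qed
  have "\<Phi> differentiable (at u)" if "u \<in> Z" for u
  proof -
    have nd: "(\<lambda>u. norm (P u)) differentiable (at u)"
      using differentiable_chain_at [OF Pdiff differentiable_norm_at [OF PZ [OF that]]]
      by (simp add: o_def)
    have id: "(\<lambda>u. inverse (norm (P u)) *\<^sub>R P u) differentiable (at u)"
      using PZ [OF that] by (intro differentiable_scaleR differentiable_inverse nd Pdiff) auto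
    have "(P \<circ> (g \<circ> (\<lambda>u. inverse (norm (P u)) *\<^sub>R P u))) differentiable (at u)"
      by (intro differentiable_chain_at id diff Pdiff)
    then have "(\<lambda>u. P (g (inverse (norm (P u)) *\<^sub>R P u))) differentiable (at u)"
      by (simp add: o_def)
    then show ?thesis
      unfolding \<Phi>_def
      by (intro differentiable_add differentiable_minus differentiable_scaleR differentiable_diff nd Pdiff
          differentiable_ident)
  qed
  then have "\<Phi> differentiable_on Z"
    by (simp add: differentiable_at_imp_differentiable_on)
  then have neg: "negligible (\<Phi> ` Z)"
    using \<open>negligible Z\<close> negligible_differentiable_image_negligible by blast
  have "\<not> ball 0 e \<subseteq> \<Phi> ` Z"
    using negligible_subset [OF neg] open_not_negligible [of "ball (0::real^'n) e"] e by auto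
  then obtain c where "c \<in> ball 0 e" and "c \<notin> \<Phi> ` Z"
    by (meson subsetI)
  then have c: "norm c < e" "c \<notin> \<Phi> ` Z"
    by auto
  show thesis
  proof (rule that [OF c(1)])
    fix x :: "real^'n"
    assume x: "norm x = 1" "\<And>j. j \<notin> I \<Longrightarrow> x $ j = 0" "x $ i \<noteq> 0"
    show "\<exists>j\<in>I. (g x + x $ i *\<^sub>R c) $ j \<noteq> 0"
    proof (rule ccontr)
      assume "\<not> ?thesis"
      then have z: "g x $ j + x $ i * c $ j = 0" if "j \<in> I" for j
        using that by auto
      \<comment> \<open>The point of the hyperplane that \<Phi> would send to c: on I it is x
        rescaled to i-th coordinate 1, off I it is copied from c.\<close>
      define u where "u = inverse (x $ i) *\<^sub>R x + (c - P c)"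
      have Pu: "P u = inverse (x $ i) *\<^sub>R x"
        using x(2) by (auto simp: vec_eq_iff P_nth u_def)
      have nPu: "norm (P u) = inverse \<bar>x $ i\<bar>"
        by (simp add: Pu x)
      have "u \<in> Z"
        using i x(3) by (simp add: Z_def u_def inner_axis' P_nth)
      \<comment> \<open>Normalizing \<open>P u\<close> gives x or - x according to the sign of
        \<open>x $ i\<close>; oddness of g covers both.\<close>
      have gg: "g (inverse (norm (P u)) *\<^sub>R P u) = sgn (x $ i) *\<^sub>R g x"
      proof (cases "x $ i > 0")
        case False
        then have "inverse (norm (P u)) *\<^sub>R P u = - x"
          using x(1,3) unfolding nPu Pu by (simp add: divide_simps)
        then show ?thesis using False x(3) odd by simp
      qed (simp add: nPu Pu x(1))
      have "\<Phi> u $ j = c $ j" for j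
      proof (cases "j \<in> I")
        case True
        have "\<Phi> u $ j = - (inverse \<bar>x $ i\<bar> * (sgn (x $ i) * g x $ j))"
          unfolding \<Phi>_def gg using True by (simp add: P_nth nPu)
        also have "\<dots> = - (g x $ j / x $ i)"
          using x(3) by (simp add: sgn_real_def divide_simps)
        also have "\<dots> = c $ j"
          using z [OF True] x(3) by (simp add: field_simps)
        finally show ?thesis .
      next
        case False
        then show ?thesis
          using x(2) by (simp add: \<Phi>_def P_nth u_def)
      qed
      then have "\<Phi> u = c"
        by (simp add: vec_eq_iff)
      with \<open>u \<in> Z\<close> c(2) show False by blast
    qed
  qed
qed

text \<open>The coordinates of I are treated one at a time. The summand
  \<open>x $ i *\<^sub>R c\<close> vanishes where \<open>x $ i = 0\<close>, so what the earlier
  coordinates achieved survives there, while the choice of c settles the points with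
  \<open>x $ i \<noteq> 0\<close>. Every unit vector supported on I is reached in this way.\<close>

lemma odd_perturbation_nonvanishing:
  fixes g :: "real^'n \<Rightarrow> real^'n" and I :: "'n set"
  assumes diff: "\<And>x. g differentiable (at x)" and odd: "\<And>x. g (- x) = - g x" and e: "e > 0"
  obtains h where "\<And>x. h differentiable (at x)" "\<And>x. h (- x) = - h x"
    "\<And>x. norm x = 1 \<Longrightarrow> norm (h x - g x) < e"
    "\<And>x. \<lbrakk>norm x = 1; \<And>j. j \<notin> I \<Longrightarrow> x $ j = 0\<rbrakk> \<Longrightarrow> \<exists>j\<in>I. h x $ j \<noteq> 0"
proof -
  have "\<exists>h. (\<forall>x. h differentiable (at x)) \<and> (\<forall>x. h (- x) = - h x) \<and>
          (\<forall>x. norm x = 1 \<longrightarrow> norm (h x - g x) < e) \<and>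
          (\<forall>x. norm x = 1 \<and> (\<forall>j. j \<notin> I \<longrightarrow> x $ j = 0) \<and> (\<exists>j\<in>K. x $ j \<noteq> 0) \<longrightarrow> (\<exists>j\<in>I. h x $ j \<noteq> 0))"
    if "finite K" "K \<subseteq> I" for K
    using that e
  proof (induction K arbitrary: e)
    case empty
    then show ?case
      using diff odd by (intro exI [of _ g]) auto
  next
    case (insert i K)
    have "e/2 > 0" "K \<subseteq> I"
      using insert by auto
    with insert.IH [OF this(2,1)] obtain h where
        hd: "\<forall>x. h differentiable (at x)" and ho: "\<forall>x. h (- x) = - h x" and
        hn: "\<forall>x. norm x = 1 \<longrightarrow> norm (h x - g x) < e/2" and
        hz: "\<forall>x. norm x = 1 \<and> (\<forall>j. j \<notin> I \<longrightarrow> x $ j = 0) \<and> (\<exists>j\<in>K. x $ j \<noteq> 0) \<longrightarrow> (\<exists>j\<in>I. h x $ j \<noteq> 0)"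
      by (elim exE conjE)
    note h = hd [rule_format] ho [rule_format] hn [rule_format]
    obtain c where c: "norm c < e/2"
      "\<And>x. \<lbrakk>norm x = 1; \<And>j. j \<notin> I \<Longrightarrow> x $ j = 0; x $ i \<noteq> 0\<rbrakk> \<Longrightarrow> \<exists>j\<in>I. (h x + x $ i *\<^sub>R c) $ j \<noteq> 0"
      using odd_avoid_zero_coordinate [OF h(1,2), of i I "e/2"] insert.prems \<open>e/2 > 0\<close> by blast
    show ?case
    proof (intro exI [of _ "\<lambda>x. h x + x $ i *\<^sub>R c"] conjI allI impI)
      fix x
      show "(\<lambda>x. h x + x $ i *\<^sub>R c) differentiable (at x)"
        by (intro differentiable_add h differentiable_scaleR differentiable_const
            bounded_linear_imp_differentiable bounded_linear_vec_nth)
      show "h (- x) + (- x) $ i *\<^sub>R c = - (h x + x $ i *\<^sub>R c)"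
        by (simp add: h)
    next
      fix x :: "real^'n" assume x: "norm x = 1"
      have "norm (x $ i *\<^sub>R c) \<le> norm c"
        using component_le_norm_cart [of x i] x by (simp add: mult_left_le_one_le)
      then show "norm (h x + x $ i *\<^sub>R c - g x) < e"
        using h(3) [OF x] c(1) norm_triangle_ineq [of "h x - g x" "x $ i *\<^sub>R c"]
        by (simp add: algebra_simps)
    next
      fix x :: "real^'n"
      assume x: "norm x = 1 \<and> (\<forall>j. j \<notin> I \<longrightarrow> x $ j = 0) \<and> (\<exists>j\<in>insert i K. x $ j \<noteq> 0)"
      show "\<exists>j\<in>I. (h x + x $ i *\<^sub>R c) $ j \<noteq> 0"
      proof (cases "x $ i = 0")
        case True
        with x have "\<exists>j\<in>K. x $ j \<noteq> 0" by auto
        then show ?thesis using hz True x by auto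
      next
        case False
        then show ?thesis using c(2) [of x] x by blast
      qed
    qed
  qed
  from this [OF finite subset_refl] obtain h where
      hd: "\<forall>x. h differentiable (at x)" and ho: "\<forall>x. h (- x) = - h x" and
      hn: "\<forall>x. norm x = 1 \<longrightarrow> norm (h x - g x) < e" and
      hz: "\<forall>x. norm x = 1 \<and> (\<forall>j. j \<notin> I \<longrightarrow> x $ j = 0) \<and> (\<exists>j\<in>I. x $ j \<noteq> 0) \<longrightarrow> (\<exists>j\<in>I. h x $ j \<noteq> 0)"
    by (elim exE conjE)
  show thesis
  proof (rule that)
    show "h differentiable (at x)" for x using hd by simp
    show "h (- x) = - h x" for x using ho by simp
    show "norm x = 1 \<Longrightarrow> norm (h x - g x) < e" for x using hn by simp
    fix x :: "real^'n"
    assume x: "norm x = 1" "\<And>j. j \<notin> I \<Longrightarrow> x $ j = 0"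
    then have "x \<noteq> 0" by auto
    then have "\<exists>j\<in>I. x $ j \<noteq> 0"
      using x(2) by (metis vec_eq_iff zero_index)
    with x hz show "\<exists>j\<in>I. h x $ j \<noteq> 0" by auto
  qed
qed

section \<open>Radial projection onto the sphere and straight-line homotopies\<close>

definition sphere_normalize :: "nat \<Rightarrow> (nat \<Rightarrow> real) \<Rightarrow> nat \<Rightarrow> real" where
  "sphere_normalize n x = (\<lambda>i. x i / sqrt (\<Sum>j\<le>n. (x j)\<^sup>2))"

lemma sum_squares_pos_Euclidean_space:
  assumes "x \<in> topspace (Euclidean_space (Suc n))" "x \<noteq> (\<lambda>i. 0)"
  shows "(\<Sum>j\<le>n. (x j)\<^sup>2) > 0"
proof -
  obtain i where "x i \<noteq> 0" using assms(2) by auto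
  moreover from this assms(1) have "i \<le> n"
    by (metis (mono_tags, lifting) mem_Collect_eq not_less_eq_eq topspace_Euclidean_space)
  ultimately show ?thesis
    by (intro sum_pos2 [of _ i]) auto
qed

lemma continuous_map_sphere_normalize:
  "continuous_map (subtopology (Euclidean_space (Suc n)) (- {\<lambda>i. 0})) (nsphere n) (sphere_normalize n)"
proof -
  let ?Y = "subtopology (Euclidean_space (Suc n)) (- {\<lambda>i. 0})"
  have pos: "(\<Sum>j\<le>n. (x j)\<^sup>2) > 0" if "x \<in> topspace ?Y" for x
    using that sum_squares_pos_Euclidean_space by auto
  have proj: "continuous_map ?Y euclideanreal (\<lambda>x. x i)" for i
    unfolding Euclidean_space_def
    by (intro continuous_map_from_subtopology continuous_map_product_projection) auto
  have "continuous_map ?Y euclideanreal (\<lambda>x. sphere_normalize n x i)" for i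
    unfolding sphere_normalize_def
    by (intro continuous_map_real_divide continuous_map_sqrt continuous_map_sum continuous_map_real_pow proj)
      (use pos in force)+
  moreover have "(\<Sum>i\<le>n. (sphere_normalize n x i)\<^sup>2) = 1" if "x \<in> topspace ?Y" for x
    using pos [OF that] by (simp add: sphere_normalize_def power_divide flip: sum_divide_distrib)
  moreover have "sphere_normalize n x i = 0" if "x \<in> topspace ?Y" "i > n" for x i
    using that by (auto simp: sphere_normalize_def topspace_Euclidean_space)
  ultimately show ?thesis
    unfolding nsphere continuous_map_in_subtopology continuous_map_componentwise_UNIV
    by auto
qed

lemma sphere_normalize_ident:
  "x \<in> topspace (nsphere n) \<Longrightarrow> sphere_normalize n x = x"
  by (simp add: sphere_normalize_def nsphere)

lemma continuous_map_Euclidean_space_component: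
  assumes "continuous_map X (Euclidean_space n) F"
  shows "continuous_map X euclideanreal (\<lambda>x. F x i)"
  using assms unfolding Euclidean_space_def continuous_map_in_subtopology continuous_map_componentwise_UNIV
  by simp

text \<open>The straight-line homotopy can be projected radially because no segment between
  corresponding values meets the origin.\<close>

lemma homotopic_sphere_normalize:
  assumes F: "continuous_map (nsphere n) (Euclidean_space (Suc n)) F"
    and G: "continuous_map (nsphere n) (Euclidean_space (Suc n)) G"
    and nz: "\<And>x t. \<lbrakk>x \<in> topspace (nsphere n); 0 \<le> t; t \<le> 1\<rbrakk> \<Longrightarrow> \<exists>i. (1 - t) * F x i + t * G x i \<noteq> 0"
  shows "homotopic_with (\<lambda>x. True) (nsphere n) (nsphere n) (sphere_normalize n \<circ> F) (sphere_normalize n \<circ> G)"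
proof -
  let ?T = "prod_topology (top_of_set {0..1::real}) (nsphere n)"
  let ?Y = "subtopology (Euclidean_space (Suc n)) (- {\<lambda>i. 0})"
  let ?h = "\<lambda>z i. (1 - fst z) * F (snd z) i + fst z * G (snd z) i"
  have comp: "continuous_map ?T euclideanreal (\<lambda>z. K (snd z) i)"
    if "continuous_map (nsphere n) (Euclidean_space (Suc n)) K" for K i
    using continuous_map_compose [OF continuous_map_snd continuous_map_Euclidean_space_component [OF that]]
    by (simp add: o_def)
  have fst: "continuous_map ?T euclideanreal fst"
    using continuous_map_fst continuous_map_in_subtopology by blast
  have "continuous_map ?T euclideanreal (\<lambda>z. ?h z i)" for i
    by (intro continuous_map_add continuous_map_real_mult comp [OF F] comp [OF G] fst
        continuous_map_diff [OF _ fst]) auto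
  moreover have "?h z i = 0" if "z \<in> topspace ?T" "i \<ge> Suc n" for z i
    using that continuous_map_image_subset_topspace [OF F] continuous_map_image_subset_topspace [OF G]
    by (auto simp: topspace_Euclidean_space image_subset_iff)
  moreover have "?h z \<noteq> (\<lambda>i. 0)" if "z \<in> topspace ?T" for z
    using nz [of "snd z" "fst z"] that by (auto simp: fun_eq_iff)
  ultimately have "continuous_map ?T ?Y ?h"
    unfolding Euclidean_space_def continuous_map_in_subtopology continuous_map_componentwise_UNIV
    by auto
  then have "continuous_map ?T (nsphere n) (sphere_normalize n \<circ> ?h)"
    by (rule continuous_map_compose [OF _ continuous_map_sphere_normalize])
  then show ?thesis
    unfolding homotopic_with_def
    by (intro exI [of _ "sphere_normalize n \<circ> ?h"]) auto
qed

text \<open>The sphere is carried to the unit sphere of a coordinate subspace of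
  \<open>real^'n\<close>, where Stone-Weierstrass and the perturbation lemma apply. The error bound
  1 is the distance of the unit sphere from the origin, so segments from f to h avoid 0. The last
  conclusion concerns the first n coordinates only, so that the last coordinate of h can later be
  made to vanish on the equator.\<close>

lemma odd_nsphere_map_approximation:
  fixes f :: "(nat \<Rightarrow> real) \<Rightarrow> nat \<Rightarrow> real"
  assumes n: "Suc n \<le> CARD('n::finite)"
    and f: "continuous_map (nsphere n) (nsphere n) f"
    and odd: "\<And>x. x \<in> topspace (nsphere n) \<Longrightarrow> f (\<lambda>i. - x i) = (\<lambda>i. - f x i)"
  obtains h where "continuous_map (nsphere n) (Euclidean_space (Suc n)) h"
    "\<And>x. h (\<lambda>i. - x i) = (\<lambda>i. - h x i)"
    "\<And>x. x \<in> topspace (nsphere n) \<Longrightarrow> (\<Sum>i\<le>n. (h x i - f x i)\<^sup>2) < 1"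
    "\<And>x. \<lbrakk>x \<in> topspace (nsphere n); x n = 0\<rbrakk> \<Longrightarrow> \<exists>i<n. h x i \<noteq> 0"
proof -
  obtain e :: "nat \<Rightarrow> 'n" where inj: "inj_on e {..n}"
    using n card_le_inj [of "{..n}" "UNIV :: 'n set"] by auto
  define tov where "tov = (\<lambda>x::nat\<Rightarrow>real. \<Sum>i\<le>n. x i *\<^sub>R axis (e i) (1::real))"
  define fromv where "fromv = (\<lambda>(u::real^'n) i. if i \<le> n then u $ e i else 0)"
  have tov_e: "tov x $ e i = x i" if "i \<le> n" for x i
  proof -
    have "tov x $ e i = (\<Sum>j\<le>n. x j * (if e i = e j then 1 else 0))"
      by (simp add: tov_def axis_def)
    also have "\<dots> = (\<Sum>j\<le>n. if j = i then x j else 0)"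
      using inj that by (intro sum.cong) (auto dest: inj_onD)
    finally have "tov x $ e i = (\<Sum>j\<le>n. if j = i then x j else 0)" .
    then show ?thesis using that by simp
  qed
  have tov_0: "tov x $ j = 0" if "j \<notin> e ` {..n}" for x j
    using that by (auto simp: tov_def axis_def intro!: sum.neutral)
  have tov_uminus: "tov (\<lambda>i. - x i) = - tov x" for x
    by (simp add: tov_def sum_negf)
  have sumn: "(\<Sum>j\<in>UNIV. (u $ j)\<^sup>2) = (\<Sum>i\<le>n. (u $ e i)\<^sup>2)" if "\<And>j. j \<notin> e ` {..n} \<Longrightarrow> u $ j = 0" for u :: "real^'n"
  proof -
    have "(\<Sum>j\<in>UNIV. (u $ j)\<^sup>2) = (\<Sum>j\<in>e ` {..n}. (u $ j)\<^sup>2)"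
      using that by (intro sum.mono_neutral_right) auto
    then show ?thesis
      by (simp add: sum.reindex [OF inj])
  qed
  have norm_tov: "(norm (tov x))\<^sup>2 = (\<Sum>i\<le>n. (x i)\<^sup>2)" for x
  proof -
    have "(norm (tov x))\<^sup>2 = (\<Sum>j\<in>UNIV. (tov x $ j)\<^sup>2)"
      by (simp add: norm_vec_def L2_set_def sum_nonneg)
    then show ?thesis
      using sumn [of "tov x"] tov_0 by (simp add: tov_e)
  qed
  define S where "S = {u::real^'n. norm u = 1 \<and> (\<forall>j. j \<notin> e ` {..n} \<longrightarrow> u $ j = 0)}"
  have tovS: "tov x \<in> S" if "x \<in> topspace (nsphere n)" for x
  proof -
    have "(norm (tov x))\<^sup>2 = 1"
      using that by (simp add: norm_tov nsphere)
    then have "norm (tov x) = 1"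
      by (simp add: power2_eq_1_iff) (smt (verit) norm_ge_zero)
    then show ?thesis
      using tov_0 by (simp add: S_def)
  qed
  have fromS: "fromv u \<in> topspace (nsphere n)" if "u \<in> S" for u
  proof -
    have "(\<Sum>i\<le>n. (u $ e i)\<^sup>2) = (norm u)\<^sup>2"
      using sumn [of u] that by (simp add: S_def norm_vec_def L2_set_def sum_nonneg)
    then show ?thesis
      using that by (simp add: nsphere fromv_def S_def)
  qed
  have from_to: "fromv (tov x) = x" if "x \<in> topspace (nsphere n)" for x
    using that by (auto simp: nsphere fromv_def fun_eq_iff tov_e)
  have "closed S"
  proof -
    have "S = sphere 0 1 \<inter> (\<Inter>j\<in>- e ` {..n}. {u. u $ j = 0})"
      by (auto simp: S_def)
    moreover have "closed {u::real^'n. u $ j = 0}" for j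
      by (intro closed_Collect_eq continuous_intros)
    ultimately show ?thesis by (simp add: closed_Int closed_INT)
  qed
  then have "compact S"
    by (auto simp: S_def compact_eq_bounded_closed bounded_iff intro!: exI [of _ 1])
  have cfrom: "continuous_map (top_of_set S) (nsphere n) fromv"
  proof -
    have "continuous_map (top_of_set S) euclideanreal (\<lambda>u. fromv u i)" for i
      unfolding fromv_def by (cases "i \<le> n") (auto intro!: continuous_intros)
    then show ?thesis
      using fromS unfolding nsphere continuous_map_in_subtopology continuous_map_componentwise_UNIV
      by (auto simp: nsphere)
  qed
  define F where "F = (\<lambda>u. tov (f (fromv u)))"
  have "continuous_on S F"
  proof -
    have "continuous_map (top_of_set S) (nsphere n) (f \<circ> fromv)"
      using cfrom f continuous_map_compose by blast
    then have "continuous_map (top_of_set S) euclideanreal (\<lambda>u. (f \<circ> fromv) u i)" for i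
      unfolding nsphere continuous_map_in_subtopology continuous_map_componentwise_UNIV by auto
    then have "continuous_on S (\<lambda>u. f (fromv u) i)" for i
      by (simp add: o_def)
    then show ?thesis
      unfolding F_def tov_def by (intro continuous_intros)
  qed
  then obtain g0 where g0: "polynomial_function g0" "\<And>u. u \<in> S \<Longrightarrow> norm (F u - g0 u) < 1/2"
    using Stone_Weierstrass_polynomial_function [OF \<open>compact S\<close>, of F "1/2"] by auto
  \<comment> \<open>The odd part of the polynomial; as F is odd on S, the error does not
    grow.\<close>
  define g where "g = (\<lambda>u. (1/2) *\<^sub>R (g0 u - g0 (- u)))"
  have g0d: "g0 differentiable (at u)" for u
    using g0(1) differentiable_at_polynomial_function by blast
  have "(g0 \<circ> uminus) differentiable (at u)" for u
    by (intro differentiable_chain_at g0d differentiable_minus differentiable_ident)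
  then have gd: "g differentiable (at u)" for u
    unfolding g_def o_def by (intro differentiable_scaleR differentiable_const differentiable_diff g0d)
  have godd: "g (- u) = - g u" for u
    by (simp add: g_def algebra_simps)
  have gF: "norm (F u - g u) < 1/2" if "u \<in> S" for u
  proof -
    have mS: "- u \<in> S" using that by (simp add: S_def)
    have "fromv (- u) = (\<lambda>i. - fromv u i)"
      by (simp add: fromv_def fun_eq_iff)
    then have Fm: "F (- u) = - F u"
      using odd [OF fromS [OF that]] by (simp add: F_def tov_uminus)
    have "F u - g u = (1/2) *\<^sub>R ((F u - g0 u) - (F (- u) - g0 (- u)))"
      unfolding Fm g_def by (simp add: scaleR_right_diff_distrib scaleR_right_distrib flip: scaleR_add_left)
    then have "norm (F u - g u) \<le> (1/2) * (norm (F u - g0 u) + norm (F (- u) - g0 (- u)))"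
      using norm_triangle_ineq4 [of "F u - g0 u" "F (- u) - g0 (- u)"] by simp
    then show ?thesis
      using g0(2) [OF that] g0(2) [OF mS] by argo
  qed
  \<comment> \<open>The coordinates from indices below n are those that support the equator. The two
    errors of 1/2, from the polynomial and from the perturbation, add up to the required 1.\<close>
  obtain H where H: "\<And>x. H differentiable (at x)" "\<And>x. H (- x) = - H x"
    "\<And>x. norm x = 1 \<Longrightarrow> norm (H x - g x) < 1/2"
    "\<And>x. \<lbrakk>norm x = 1; \<And>j. j \<notin> e ` {..<n} \<Longrightarrow> x $ j = 0\<rbrakk> \<Longrightarrow> \<exists>j\<in>e ` {..<n}. H x $ j \<noteq> 0"
    using odd_perturbation_nonvanishing [OF gd godd, of "1/2" "e ` {..<n}"] by auto
  show thesis
  proof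
    let ?h = "\<lambda>x. fromv (H (tov x))"
    have "continuous_map (nsphere n) euclidean tov"
      unfolding tov_def nsphere euclidean_product_topology
      by (auto intro!: continuous_intros continuous_on_product_coordinates
          intro: continuous_on_subset [OF continuous_on_product_coordinates])
    moreover have "continuous_map euclidean euclidean H"
      using H(1) by (simp add: continuous_on_eq_continuous_within differentiable_imp_continuous_within)
    ultimately have "continuous_map (nsphere n) euclidean (H \<circ> tov)"
      by (rule continuous_map_compose)
    then have "continuous_map (nsphere n) euclideanreal ((\<lambda>v. v $ e i) \<circ> (H \<circ> tov))" for i
      by (rule continuous_map_compose) (auto intro: continuous_intros)
    then have "continuous_map (nsphere n) (Euclidean_space (Suc n)) (\<lambda>x i. if i < Suc n then (H \<circ> tov) x $ e i else 0)"
      unfolding continuous_map_componentwise_Euclidean_space by (simp add: o_def)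
    then show "continuous_map (nsphere n) (Euclidean_space (Suc n)) ?h"
      unfolding fromv_def less_Suc_eq_le o_def .
    show "?h (\<lambda>i. - x i) = (\<lambda>i. - ?h x i)" for x
      by (simp add: tov_uminus H(2) fromv_def fun_eq_iff)
    show "(\<Sum>i\<le>n. (?h x i - f x i)\<^sup>2) < 1" if x: "x \<in> topspace (nsphere n)" for x
    proof -
      let ?u = "tov x"
      have u: "?u \<in> S" by (rule tovS [OF x])
      have Fu: "F ?u = tov (f x)"
        by (simp add: F_def from_to [OF x])
      have "norm (H ?u - F ?u) < 1"
        using H(3) [of ?u] gF [OF u] u norm_triangle_ineq4 [of "H ?u - g ?u" "F ?u - g ?u"]
        by (simp add: S_def)
      then have "(norm (H ?u - F ?u))\<^sup>2 < 1"
        by (simp add: power_less_one_iff abs_square_less_1)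
      moreover have "(\<Sum>i\<le>n. (?h x i - f x i)\<^sup>2) = (\<Sum>i\<le>n. ((H ?u - F ?u) $ e i)\<^sup>2)"
        by (intro sum.cong) (auto simp: Fu tov_e fromv_def)
      moreover have "\<dots> = (\<Sum>j\<in>e ` {..n}. ((H ?u - F ?u) $ j)\<^sup>2)"
        by (simp add: sum.reindex [OF inj])
      moreover have "\<dots> \<le> (\<Sum>j\<in>UNIV. ((H ?u - F ?u) $ j)\<^sup>2)"
        by (intro sum_mono2) auto
      moreover have "\<dots> = (norm (H ?u - F ?u))\<^sup>2"
        by (simp add: norm_vec_def L2_set_def sum_nonneg)
      ultimately show ?thesis by linarith
    qed
    show "\<exists>i<n. ?h x i \<noteq> 0" if x: "x \<in> topspace (nsphere n)" "x n = 0" for x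
    proof -
      have "tov x $ j = 0" if "j \<notin> e ` {..<n}" for j
      proof (cases "j = e n")
        case True
        then show ?thesis using x(2) by (simp add: tov_e)
      next
        case False
        with that have "j \<notin> e ` {..n}"
          by (auto simp: le_less)
        then show ?thesis by (rule tov_0)
      qed
      then obtain j where "j \<in> e ` {..<n}" "H (tov x) $ j \<noteq> 0"
        using H(4) [of "tov x"] tovS [OF x(1)] by (auto simp: S_def)
      then show ?thesis
        by (auto simp: fromv_def)
    qed
  qed
qed

text \<open>The type \<open>'n\<close> only supplies a Euclidean space large enough for the approximation step.\<close>

theorem odd_nsphere_map_odd_degree:
  fixes f :: "(nat \<Rightarrow> real) \<Rightarrow> nat \<Rightarrow> real"
  assumes "Suc n \<le> CARD('n::finite)"
    and "continuous_map (nsphere n) (nsphere n) f"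
    and "\<And>x. x \<in> topspace (nsphere n) \<Longrightarrow> f (\<lambda>i. - x i) = (\<lambda>i. - f x i)"
  shows "odd (Brouwer_degree2 n f)"
  using assms
proof (induction n arbitrary: f)
  case 0
  \<comment> \<open>The 0-sphere has two points, so an odd map is the identity or the reflection, of
    degree 1 or -1.\<close>
  have S0: "x \<in> topspace (nsphere 0) \<longleftrightarrow> x = (\<lambda>i. if i = 0 then 1 else 0) \<or> x = (\<lambda>i. if i = 0 then -1 else 0)" for x
    by (auto simp: nsphere fun_eq_iff power2_eq_1_iff)
  let ?p = "\<lambda>i::nat. if i = 0 then 1 else 0 :: real"
  let ?m = "\<lambda>i::nat. if i = 0 then -1 else 0 :: real"
  have pm: "(\<lambda>i. - ?p i) = ?m" "(\<lambda>i. - ?m i) = ?p"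
    by (auto simp: fun_eq_iff)
  have "f ?m = (\<lambda>i. - f ?p i)"
    using "0.prems"(3) [of ?p] pm by (simp add: S0)
  moreover have "f ?p \<in> topspace (nsphere 0)"
    using continuous_map_image_subset_topspace [OF "0.prems"(2)] S0 by blast
  ultimately consider "f ?p = ?p" "f ?m = ?m" | "f ?p = ?m" "f ?m = ?p"
    using pm by (auto simp: S0)
  then show ?case
  proof cases
    case 1
    then have "Brouwer_degree2 0 f = Brouwer_degree2 0 id"
      by (intro Brouwer_degree2_eq) (auto simp: S0)
    then show ?thesis by simp
  next
    case 2
    then have "Brouwer_degree2 0 f = Brouwer_degree2 0 (\<lambda>x i. if i = 0 then -x i else x i)"
      using pm by (intro Brouwer_degree2_eq) (auto simp: S0 cong: if_cong)
    then show ?thesis by (simp only: Brouwer_degree2_reflection) simp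
  qed
next
  case (Suc n f)
  let ?S = "nsphere (Suc n)"
  obtain h where h: "continuous_map ?S (Euclidean_space (Suc (Suc n))) h"
    "\<And>x. h (\<lambda>i. - x i) = (\<lambda>i. - h x i)"
    "\<And>x. x \<in> topspace ?S \<Longrightarrow> (\<Sum>i\<le>Suc n. (h x i - f x i)\<^sup>2) < 1"
    "\<And>x. \<lbrakk>x \<in> topspace ?S; x (Suc n) = 0\<rbrakk> \<Longrightarrow> \<exists>i<Suc n. h x i \<noteq> 0"
    using odd_nsphere_map_approximation [OF Suc.prems] by blast
  \<comment> \<open>vanishes in the last coordinate on the equator, and the segment from h to k avoids 0\<close>
  define k where "k = (\<lambda>x i. if i = Suc n then \<bar>x i\<bar> * h x i else h x i)"
  define K where "K = sphere_normalize (Suc n) \<circ> k"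
  have fS: "continuous_map ?S (Euclidean_space (Suc (Suc n))) f"
    using Suc.prems(2) unfolding nsphere_def continuous_map_in_subtopology by blast
  have hc: "continuous_map ?S euclideanreal (\<lambda>x. h x i)" for i
    by (rule continuous_map_Euclidean_space_component [OF h(1)])
  have h0: "h x i = 0" if "x \<in> topspace ?S" "i \<ge> Suc (Suc n)" for x i
    using continuous_map_image_subset_topspace [OF h(1)] that
    by (auto simp: topspace_Euclidean_space image_subset_iff)
  have "continuous_map ?S euclideanreal (\<lambda>x. k x i)" for i
    unfolding k_def
    by (cases "i = Suc n") (auto intro!: continuous_map_real_mult continuous_map_real_abs hc continuous_map_nsphere_projection)
  then have kc: "continuous_map ?S (Euclidean_space (Suc (Suc n))) k"
    using h0 by (subst Euclidean_space_def)
      (auto simp: continuous_map_in_subtopology continuous_map_componentwise_UNIV k_def)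
  have f1: "(\<Sum>i\<le>Suc n. (f x i)\<^sup>2) = 1" if "x \<in> topspace ?S" for x
    using continuous_map_image_subset_topspace [OF Suc.prems(2)] that
    by (auto simp: nsphere image_subset_iff)
  \<comment> \<open>A zero on the segment would give f = - t (h - f), whose norm is less than 1, on
    the unit sphere.\<close>
  have 1: "homotopic_with (\<lambda>x. True) ?S ?S (sphere_normalize (Suc n) \<circ> f) (sphere_normalize (Suc n) \<circ> h)"
  proof (rule homotopic_sphere_normalize [OF fS h(1)], rule ccontr)
    fix x and t :: real
    assume x: "x \<in> topspace ?S" and t: "0 \<le> t" "t \<le> 1" and "\<not> (\<exists>i. (1 - t) * f x i + t * h x i \<noteq> 0)"
    then have "f x i = - (t * (h x i - f x i))" for i
      by (simp add: algebra_simps)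
    then have "(f x i)\<^sup>2 = (t * (h x i - f x i))\<^sup>2" for i
      by (metis power2_minus)
    then have "(\<Sum>i\<le>Suc n. (f x i)\<^sup>2) = (\<Sum>i\<le>Suc n. (t * (h x i - f x i))\<^sup>2)"
      by (simp only:)
    also have "\<dots> = t\<^sup>2 * (\<Sum>i\<le>Suc n. (h x i - f x i)\<^sup>2)"
      by (simp only: power_mult_distrib sum_distrib_left)
    also have "\<dots> \<le> (\<Sum>i\<le>Suc n. (h x i - f x i)\<^sup>2)"
      using t by (intro mult_left_le_one_le sum_nonneg) (auto simp: power_le_one)
    finally show False
      using h(3) [OF x] f1 [OF x] by linarith
  qed
  \<comment> \<open>If all coordinates of h but the last vanish, then x is off the equator and the
    last one is nonzero; k multiplies it by a positive number, so nothing cancels along the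
    segment.\<close>
  have nz: "\<exists>i. (1 - t) * h x i + t * k x i \<noteq> 0" if x: "x \<in> topspace ?S" and t: "0 \<le> t" "t \<le> 1" for x t
  proof (cases "\<exists>i<Suc n. h x i \<noteq> 0")
    case True
    then obtain i where "i < Suc n" "h x i \<noteq> 0" by blast
    then have "(1 - t) * h x i + t * k x i \<noteq> 0"
      by (simp add: k_def flip: distrib_right)
    then show ?thesis by blast
  next
    case False
    then have xn: "x (Suc n) \<noteq> 0" using h(4) [OF x] by blast
    have "h x (Suc n) \<noteq> 0"
    proof
      assume "h x (Suc n) = 0"
      with False have "h x i = 0" if "i \<le> Suc n" for i
        using that by (metis le_SucE less_Suc_eq_le)
      then have "(\<Sum>i\<le>Suc n. (f x i)\<^sup>2) = (\<Sum>i\<le>Suc n. (h x i - f x i)\<^sup>2)"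
        by (intro sum.cong) auto
      then show False using f1 [OF x] h(3) [OF x] by simp
    qed
    moreover have "(1 - t) + t * \<bar>x (Suc n)\<bar> > 0"
      using t xn by (cases "t = 0") (auto intro!: add_nonneg_pos)
    ultimately have "((1 - t) + t * \<bar>x (Suc n)\<bar>) * h x (Suc n) \<noteq> 0"
      by simp
    then have "(1 - t) * h x (Suc n) + t * k x (Suc n) \<noteq> 0"
      by (simp add: k_def algebra_simps)
    then show ?thesis by blast
  qed
  have 2: "homotopic_with (\<lambda>x. True) ?S ?S (sphere_normalize (Suc n) \<circ> h) K"
    unfolding K_def by (rule homotopic_sphere_normalize [OF h(1) kc nz])
  have "Brouwer_degree2 (Suc n) f = Brouwer_degree2 (Suc n) (sphere_normalize (Suc n) \<circ> f)"
    using continuous_map_image_subset_topspace [OF Suc.prems(2)]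
    by (intro Brouwer_degree2_eq) (auto simp: sphere_normalize_ident)
  also have "\<dots> = Brouwer_degree2 (Suc n) K"
    using homotopic_with_trans [OF 1 2] by (rule Brouwer_degree2_homotopic)
  finally have deg: "Brouwer_degree2 (Suc n) f = Brouwer_degree2 (Suc n) K" .
  have Kc: "continuous_map ?S ?S K"
    using 2 homotopic_with_imp_continuous_maps by blast
  have Kodd: "K (\<lambda>i. - x i) = (\<lambda>i. - K x i)" for x
    by (auto simp: K_def k_def h(2) sphere_normalize_def fun_eq_iff cong: if_cong intro!: arg_cong [where f = sqrt] sum.cong)
  have sub: "topspace (nsphere n) \<subseteq> topspace ?S"
    by (metis subtopology_nsphere_equator inf_le1 topspace_subtopology)
  have Kn: "K x \<in> topspace (nsphere n)" if x: "x \<in> topspace (nsphere n)" for x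
  proof -
    have "x (Suc n) = 0" using x by (simp add: nsphere)
    then have "K x (Suc n) = 0"
      by (simp add: K_def k_def sphere_normalize_def)
    moreover have "K x \<in> topspace ?S"
      using x sub continuous_map_image_subset_topspace [OF Kc] by blast
    ultimately show ?thesis
      using topspace_nsphere_minus1 [of "K x" "Suc n"] by simp
  qed
  have "continuous_map (nsphere n) (nsphere n) K"
  proof -
    have "continuous_map (nsphere n) ?S K"
      using continuous_map_from_subtopology [OF Kc, of "{x. x (Suc n) = 0}"]
      by (simp only: subtopology_nsphere_equator)
    then have "continuous_map (nsphere n) (subtopology ?S {x. x (Suc n) = 0}) K"
      using Kn by (simp add: continuous_map_in_subtopology nsphere)
    then show ?thesis
      by (simp only: subtopology_nsphere_equator)
  qed
  then have "odd (Brouwer_degree2 n K)"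
    using Suc.IH Suc.prems(1) Kodd by auto
  moreover have "even (Brouwer_degree2 (Suc n) K - Brouwer_degree2 (Suc n - Suc 0) K)"
    by (rule Borsuk_odd_mapping_degree_step [OF Kc]) (use Kodd Kn in auto)
  ultimately show ?case
    using deg by simp
qed

text \<open>Followed by the radial projection, an odd map would become a self-map of the n-sphere of
  odd degree. But coordinate n of its values vanishes because j \<le> n, so it is not surjective and
  its degree is 0.\<close>

theorem Borsuk_Ulam_nsphere:
  assumes n: "Suc n \<le> CARD('n::finite)" and j: "j \<le> n"
    and f: "continuous_map (nsphere n) (subtopology (Euclidean_space j) (topspace (Euclidean_space j) - {\<lambda>i. 0})) f"
  shows "\<exists>x\<in>topspace (nsphere n). f (\<lambda>i. - x i) \<noteq> (\<lambda>i. - f x i)"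
proof (rule ccontr)
  assume "\<not> ?thesis"
  then have odd: "f (\<lambda>i. - x i) = (\<lambda>i. - f x i)" if "x \<in> topspace (nsphere n)" for x
    using that by blast
  have fj: "f x \<noteq> (\<lambda>i. 0)" "f x i = 0" if "x \<in> topspace (nsphere n)" "i \<ge> j" for x i
    using continuous_map_image_subset_topspace [OF f] that
    by (auto simp: topspace_Euclidean_space image_subset_iff)
  have f2: "continuous_map (nsphere n) (Euclidean_space j) f"
    using f continuous_map_in_subtopology by blast
  have "continuous_map (nsphere n) euclideanreal (\<lambda>x. f x i)" for i
    by (rule continuous_map_Euclidean_space_component [OF f2])
  then have "continuous_map (nsphere n) (subtopology (Euclidean_space (Suc n)) (- {\<lambda>i. 0})) f"
    unfolding Euclidean_space_def continuous_map_in_subtopology continuous_map_componentwise_UNIV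
    using fj j by force
  then have c: "continuous_map (nsphere n) (nsphere n) (sphere_normalize n \<circ> f)"
    by (rule continuous_map_compose [OF _ continuous_map_sphere_normalize])
  have "odd (Brouwer_degree2 n (sphere_normalize n \<circ> f))"
    by (rule odd_nsphere_map_odd_degree [OF n c]) (simp add: odd sphere_normalize_def fun_eq_iff)
  moreover have "Brouwer_degree2 n (sphere_normalize n \<circ> f) = 0"
  proof (rule Brouwer_degree2_nonsurjective [OF c])
    let ?q = "\<lambda>i. if i = n then 1 else 0 :: real"
    have "?q \<in> topspace (nsphere n)"
      by (simp add: nsphere if_distrib [where f = "\<lambda>x. x^2"] cong: if_cong)
    moreover have "?q \<notin> (sphere_normalize n \<circ> f) ` topspace (nsphere n)"
    proof
      assume "?q \<in> (sphere_normalize n \<circ> f) ` topspace (nsphere n)"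
      then obtain x where x: "x \<in> topspace (nsphere n)" "?q = sphere_normalize n (f x)"
        by auto
      have "?q n = 0"
        using fun_cong [OF x(2), of n] fj(2) [OF x(1) j] by (simp add: sphere_normalize_def)
      then show False by simp
    qed
    ultimately show "(sphere_normalize n \<circ> f) ` topspace (nsphere n) \<noteq> topspace (nsphere n)"
      by blast
  qed
  ultimately show False by simp
qed


section \<open>The Lovasz extension as an integral over superlevel sets\<close>

definition superlevel :: "real ^ 'n \<Rightarrow> real \<Rightarrow> 'n set" where
  "superlevel x t = {v. t < x $ v}"

lemma has_integral_below:
  fixes \<phi> :: "real \<Rightarrow> real"
  assumes "(\<phi> has_integral i) {a..c}" "c \<le> b"
  shows "((\<lambda>t. \<phi> t * (if t < c then 1 else 0)) has_integral i) {a..b}"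
proof -
  have "((\<lambda>t. if t \<in> {a..c} then \<phi> t else 0) has_integral i) {a..b}"
    using assms by (subst has_integral_restrict) auto
  then show ?thesis
    by (rule has_integral_spike_finite [of "{c}", rotated 2]) auto
qed

text \<open>Layer-cake formula: a vertex is counted at the levels below its value, where \<phi>
  integrates to \<Phi>. It serves with \<phi> = 1 for inner products and with \<phi> = p t^(p - 1)
  for weighted sums of p-th powers.\<close>

lemma has_integral_superlevel_sum:
  fixes \<phi> :: "real \<Rightarrow> real" and x :: "real ^ 'n::finite" and y :: "'n \<Rightarrow> real"
  assumes "\<And>c. \<lbrakk>a \<le> c; c \<le> b\<rbrakk> \<Longrightarrow> (\<phi> has_integral \<Phi> c) {a..c}"
    and "\<And>v. a \<le> x $ v \<and> x $ v \<le> b"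
  shows "((\<lambda>t. \<phi> t * sum y (superlevel x t)) has_integral (\<Sum>v\<in>UNIV. y v * \<Phi> (x $ v))) {a..b}"
proof -
  have "((\<lambda>t. \<Sum>v\<in>UNIV. y v * (\<phi> t * (if t < x $ v then 1 else 0))) has_integral (\<Sum>v\<in>UNIV. y v * \<Phi> (x $ v))) {a..b}"
    using assms by (intro has_integral_sum has_integral_mult_right has_integral_below) auto
  moreover have "(\<Sum>v\<in>UNIV. y v * (\<phi> t * (if t < x $ v then 1 else 0))) = \<phi> t * sum y (superlevel x t)" for t
  proof -
    have "sum y (superlevel x t) = (\<Sum>v\<in>UNIV. if t < x $ v then y v else 0)"
      by (simp add: superlevel_def sum.If_cases)
    then show ?thesis
      by (auto simp: sum_distrib_left intro!: sum.cong)
  qed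
  ultimately show ?thesis by simp
qed

lemma has_integral_superlevel_inner:
  fixes x y :: "real ^ 'n::finite"
  assumes "\<And>v. a \<le> x $ v \<and> x $ v \<le> b" and "(\<Sum>v\<in>UNIV. y $ v) = 0"
  shows "((\<lambda>t. \<Sum>v\<in>superlevel x t. y $ v) has_integral y \<bullet> x) {a..b}"
proof -
  have one: "((\<lambda>t. 1 :: real) has_integral c - a) {a..c}" if "a \<le> c" for c
    using has_integral_const_real [of "1::real" a c] that by simp
  have "((\<lambda>t. 1 * (\<Sum>v\<in>superlevel x t. y $ v)) has_integral (\<Sum>v\<in>UNIV. y $ v * (x $ v - a))) {a..b}"
    using assms one by (intro has_integral_superlevel_sum) auto
  \<comment> \<open>The shift by a drops out because the entries of y sum to 0.\<close>
  moreover have "(\<Sum>v\<in>UNIV. y $ v * (x $ v - a)) = y \<bullet> x"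
    using assms(2) by (simp add: inner_vec_def right_diff_distrib sum_subtractf flip: sum_distrib_right)
  ultimately show ?thesis by simp
qed

lemma has_integral_power_derivative:
  fixes p c :: real
  assumes "p \<ge> 1" "0 \<le> c"
  shows "((\<lambda>t. p * t powr (p - 1)) has_integral c powr p) {0..c}"
proof -
  have "((\<lambda>t. p * t powr (p - 1)) has_integral c powr p - 0 powr p) {0..c}"
  \<comment> \<open>The interior form is used because the derivative rule for \<open>powr\<close>
    needs a positive argument.\<close>
  proof (rule fundamental_theorem_of_calculus_interior [OF assms(2)])
    show "continuous_on {0..c} (\<lambda>t. t powr p)"
      using assms(1) by (intro continuous_on_powr' continuous_intros) auto
    show "((\<lambda>t. t powr p) has_vector_derivative p * t powr (p - 1)) (at t)" if "t \<in> {0<..<c}" for t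
      using that has_real_derivative_powr [of t p] by (simp add: has_real_derivative_iff_has_vector_derivative)
  qed
  then show ?thesis using assms by simp
qed

text \<open>The superlevel set takes finitely many values, each on a Borel set of levels, so any
  function g of it is measurable and bounded.\<close>

lemma integrable_on_superlevel:
  fixes \<phi> :: "real \<Rightarrow> real" and x :: "real ^ 'n::finite" and g :: "'n set \<Rightarrow> real"
  assumes [measurable]: "\<phi> \<in> borel_measurable borel" and bound: "\<And>t. \<lbrakk>a \<le> t; t \<le> b\<rbrakk> \<Longrightarrow> \<bar>\<phi> t\<bar> \<le> C"
  shows "(\<lambda>t. \<phi> t * g (superlevel x t)) integrable_on {a..b}"
proof -
  have "{t. superlevel x t = S} \<in> sets borel" for S
  proof -
    have "superlevel x t = S \<longleftrightarrow> (\<forall>v\<in>S. t < x $ v) \<and> (\<forall>v\<in>- S. x $ v \<le> t)" for t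
      unfolding superlevel_def set_eq_iff mem_Collect_eq Ball_def Compl_iff not_less [symmetric] by blast
    then have "{t. superlevel x t = S} = (\<Inter>v\<in>S. {..<x $ v}) \<inter> (\<Inter>v\<in>- S. {x $ v..})"
      by auto
    moreover have "(\<Inter>v\<in>S. {..<x $ v}) \<in> sets borel" "(\<Inter>v\<in>- S. {x $ v..}) \<in> sets borel"
      by (rule sets.countable_INT''; simp add: countable_finite)+
    ultimately show ?thesis by simp
  qed
  then have "(\<lambda>t. superlevel x t) \<in> measurable borel (count_space UNIV)"
    by (simp add: measurable_count_space_eq2 vimage_def)
  then have g: "(\<lambda>t. g (superlevel x t)) \<in> borel_measurable borel"
    by (rule measurable_compose) simp
  have "(\<lambda>t. \<phi> t * g (superlevel x t)) \<in> borel_measurable lborel"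
    using borel_measurable_times [OF assms(1) g] by simp
  then have meas: "(\<lambda>t. \<phi> t * g (superlevel x t)) \<in> borel_measurable (lebesgue_on {a..b})"
    by (rule measurable_restrict_space1 [OF measurable_completion])
  have bnd: "\<bar>\<phi> t * g (superlevel x t)\<bar> \<le> C * (\<Sum>S\<in>UNIV. \<bar>g S\<bar>)" if "t \<in> {a..b}" for t
  proof -
    have "\<bar>g (superlevel x t)\<bar> \<le> (\<Sum>S\<in>UNIV. \<bar>g S\<bar>)"
      by (rule member_le_sum) simp_all
    moreover have "\<bar>\<phi> t\<bar> \<le> C"
      using bound that by simp
    moreover from this have "0 \<le> C"
      by linarith
    ultimately show ?thesis
      unfolding abs_mult by (intro mult_mono) simp_all
  qed
  show ?thesis
    by (rule measurable_bounded_by_integrable_imp_integrable_real [OF meas integrable_const_ivl bnd]) simp_all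
qed

lemma integrable_on_superlevel_unweighted:
  fixes x :: "real ^ 'n::finite" and g :: "'n set \<Rightarrow> real"
  shows "(\<lambda>t. g (superlevel x t)) integrable_on {a..b}"
  using integrable_on_superlevel [of "\<lambda>t. 1" a b 1 g x] by simp

lemma integrable_on_superlevel_power:
  fixes x :: "real ^ 'n::finite" and g :: "'n set \<Rightarrow> real"
  assumes "p \<ge> 1"
  shows "(\<lambda>t. p * t powr (p - 1) * g (superlevel x t)) integrable_on {0..b}"
  using assms
  by (intro integrable_on_superlevel [where C = "p * b powr (p - 1)"])
    (auto intro!: mult_left_mono powr_mono2 simp: abs_mult)

lemma bounded_components:
  fixes x :: "real ^ 'n"
  obtains b where "b \<ge> 0" "\<And>v. \<bar>x $ v\<bar> \<le> b"
  using component_le_norm_cart norm_ge_zero by blast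

text \<open>Models the cut function of one edge e. Intersecting with e extends the weight to all
  vertex sets and turns symmetry within e into symmetry under the complement in the whole vertex
  set.\<close>

locale symmetric_submodular =
  fixes w :: "'n::finite set \<Rightarrow> real"
  assumes nonneg: "0 \<le> w S"
    and submodular: "w (S \<union> T) + w (S \<inter> T) \<le> w S + w T"
    and empty [simp]: "w {} = 0"
    and compl: "w (- S) = w S"
begin

definition base :: "(real ^ 'n) set" where
  "base = {y. (\<forall>S. (\<Sum>v\<in>S. y $ v) \<le> w S) \<and> (\<Sum>v\<in>UNIV. y $ v) = 0}"

lemma UNIV_0 [simp]: "w UNIV = 0"
  using compl [of "{}"] by simp

lemma zero_Un: "w S = 0 \<Longrightarrow> w T = 0 \<Longrightarrow> w (S \<union> T) = 0"
  using submodular [of S T] nonneg [of "S \<union> T"] nonneg [of "S \<inter> T"] by simp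

lemma zero_Int: "w S = 0 \<Longrightarrow> w T = 0 \<Longrightarrow> w (S \<inter> T) = 0"
  using submodular [of S T] nonneg [of "S \<union> T"] nonneg [of "S \<inter> T"] by simp

lemma zero_UN: "finite K \<Longrightarrow> (\<And>i. i \<in> K \<Longrightarrow> w (F i) = 0) \<Longrightarrow> w (\<Union>i\<in>K. F i) = 0"
  by (induction K rule: finite_induct) (auto intro: zero_Un)

lemma zero_INT: "finite K \<Longrightarrow> (\<And>i. i \<in> K \<Longrightarrow> w (F i) = 0) \<Longrightarrow> w (\<Inter>i\<in>K. F i) = 0"
  by (induction K rule: finite_induct) (auto intro: zero_Int)

text \<open>Submodularity is used twice: against Z, and then for S \<union> Z against the complement
  of Z, which has weight zero by symmetry.\<close>

lemma split_zero:
  assumes "w Z = 0"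
  shows "w (S \<inter> Z) + w (S - Z) \<le> w S"
proof -
  have "w (S \<union> Z) + w (S \<inter> Z) \<le> w S"
    using submodular [of S Z] assms by simp
  moreover have "w (S - Z) \<le> w (S \<union> Z)"
  proof -
    have "(S \<union> Z) \<inter> - Z = S - Z" "(S \<union> Z) \<union> - Z = UNIV" by auto
    then show ?thesis
      using submodular [of "S \<union> Z" "- Z"] compl [of Z] assms by simp
  qed
  ultimately show ?thesis by linarith
qed

lemma base_le: "y \<in> base \<Longrightarrow> (\<Sum>v\<in>S. y $ v) \<le> w S"
  by (simp add: base_def)

lemma base_UNIV: "y \<in> base \<Longrightarrow> (\<Sum>v\<in>UNIV. y $ v) = 0"
  by (simp add: base_def)

text \<open>By symmetry, - y(S) = y(- S) \<le> w(- S) = w(S). From this central symmetry come both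
  the evenness of the Lovasz extension and the two-sided bound on y(S).\<close>

lemma base_uminus: "y \<in> base \<Longrightarrow> - y \<in> base"
proof -
  assume y: "y \<in> base"
  have "- (\<Sum>v\<in>S. y $ v) \<le> w S" for S
  proof -
    have "(\<Sum>v\<in>UNIV. y $ v) = (\<Sum>v\<in>S. y $ v) + (\<Sum>v\<in>- S. y $ v)"
      using sum.subset_diff [of S UNIV "\<lambda>v. y $ v"] by (simp add: Compl_eq_Diff_UNIV)
    then show ?thesis
      using base_le [OF y, of "- S"] base_UNIV [OF y] compl [of S] by simp
  qed
  then show ?thesis
    using base_UNIV [OF y] by (simp add: base_def sum_negf)
qed

lemma base_abs_le:
  assumes "y \<in> base"
  shows "\<bar>\<Sum>v\<in>S. y $ v\<bar> \<le> w S"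
  using base_le [OF assms, of S] base_le [OF base_uminus [OF assms], of S] by (simp add: sum_negf abs_le_iff)

text \<open>Edmonds' greedy algorithm: vertices are inserted in order of decreasing value of x.\<close>

lemma greedy_base:
  obtains y where "y \<in> base" "\<And>t. (\<Sum>v\<in>superlevel x t. y $ v) = w (superlevel x t)"
proof -
  have "\<exists>y. (\<forall>S\<subseteq>A. (\<Sum>v\<in>S. y v) \<le> w S) \<and> (\<Sum>v\<in>A. y v) = w A \<and>
            (\<forall>t. (\<Sum>v\<in>A \<inter> superlevel x t. y v) = w (A \<inter> superlevel x t))" for A
  \<comment> \<open>Ranking by - x makes the last inserted vertex u one of smallest value, so within
    \<open>insert u A\<close> a superlevel set is either everything or already a superlevel set
    within A.\<close>
  proof (induction A rule: finite_ranking_induct [where f = "\<lambda>v. - x $ v", OF finite])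
    case 1
    then show ?case by auto
  next
    case (2 u A)
    show ?case
    proof (cases "u \<in> A")
      case True
      then show ?thesis using 2 by (simp add: insert_absorb)
    next
      case False
      obtain y where y: "\<And>S. S \<subseteq> A \<Longrightarrow> (\<Sum>v\<in>S. y v) \<le> w S" "(\<Sum>v\<in>A. y v) = w A"
        "\<And>t. (\<Sum>v\<in>A \<inter> superlevel x t. y v) = w (A \<inter> superlevel x t)"
        using 2 by blast
      \<comment> \<open>The new entry is the marginal weight of u, which keeps the whole set
        tight.\<close>
      define y' where "y' = y(u := w (insert u A) - w A)"
      have y': "(\<Sum>v\<in>S. y' v) = (\<Sum>v\<in>S. y v)" if "u \<notin> S" for S
        using that by (intro sum.cong) (auto simp: y'_def)
      have tight: "(\<Sum>v\<in>insert u A. y' v) = w (insert u A)"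
        using False y(2) by (simp add: y') (simp add: y'_def)
      have "(\<Sum>v\<in>S. y' v) \<le> w S" if S: "S \<subseteq> insert u A" for S
      proof (cases "u \<in> S")
        case False
        then show ?thesis using S y(1) [of S] by (auto simp: y')
      next
        case True
        have "S \<union> A = insert u A" "S \<inter> A = S - {u}"
          using S True False by auto
        then have "w (insert u A) + w (S - {u}) \<le> w S + w A"
          using submodular [of S A] by simp
        moreover have "(\<Sum>v\<in>S. y' v) = y' u + (\<Sum>v\<in>S - {u}. y v)"
          using True by (simp add: sum.remove [of S u] y')
        moreover have "(\<Sum>v\<in>S - {u}. y v) \<le> w (S - {u})"
          using S by (intro y(1)) auto
        ultimately show ?thesis by (simp add: y'_def)
      qed
      moreover have "(\<Sum>v\<in>insert u A \<inter> superlevel x t. y' v) = w (insert u A \<inter> superlevel x t)" for t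
      proof (cases "t < x $ u")
        case True
        then have "insert u A \<inter> superlevel x t = insert u A"
          using 2(2) by (force simp: superlevel_def)
        then show ?thesis using tight by simp
      next
        case u: False
        then have "insert u A \<inter> superlevel x t = A \<inter> superlevel x t"
          by (auto simp: superlevel_def)
        then show ?thesis using y(3) False by (simp add: y')
      qed
      ultimately show ?thesis using tight by blast
    qed
  qed
  from this [of UNIV] obtain y where y: "\<And>S. (\<Sum>v\<in>S. y v) \<le> w S" "(\<Sum>v\<in>UNIV. y v) = w UNIV"
     "\<And>t. (\<Sum>v\<in>superlevel x t. y v) = w (superlevel x t)"
    by auto
  show thesis
    by (rule that [of "\<chi> v. y v"]) (use y in \<open>auto simp: base_def\<close>)
qed

lemma inner_le_integral:
  assumes "y \<in> base" "\<And>v. a \<le> x $ v \<and> x $ v \<le> b"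
  shows "y \<bullet> x \<le> integral {a..b} (\<lambda>t. w (superlevel x t))"
  using assms base_le
  by (intro has_integral_le [OF has_integral_superlevel_inner integrable_integral])
    (auto simp: base_UNIV integrable_on_superlevel_unweighted)

definition lovasz :: "real ^ 'n \<Rightarrow> real" where
  "lovasz x = (SUP y\<in>base. y \<bullet> x)"

text \<open>For y in the base polytope, y is at most w on every superlevel set, and the greedy
  vector has equality at all levels; integration turns this into a maximum. Any interval containing
  the values of x will do, because below and above them the superlevel set is everything or empty
  and has weight 0.\<close>

lemma lovasz_eq_integral:
  assumes ab: "\<And>v. a \<le> x $ v \<and> x $ v \<le> b"
  shows "lovasz x = integral {a..b} (\<lambda>t. w (superlevel x t))"
proof -
  obtain y where y: "y \<in> base" "\<And>t. (\<Sum>v\<in>superlevel x t. y $ v) = w (superlevel x t)"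
    by (rule greedy_base [of x]) (rule that)
  have "((\<lambda>t. \<Sum>v\<in>superlevel x t. y $ v) has_integral y \<bullet> x) {a..b}"
    using assms y(1) by (intro has_integral_superlevel_inner) (auto simp: base_UNIV)
  then have "y \<bullet> x = integral {a..b} (\<lambda>t. w (superlevel x t))"
    by (simp add: y(2) integral_unique)
  then have "integral {a..b} (\<lambda>t. w (superlevel x t)) \<in> (\<lambda>y. y \<bullet> x) ` base"
    using y(1) by (metis imageI)
  then show ?thesis
    unfolding lovasz_def using inner_le_integral [OF _ ab]
    by (intro cSup_eq_maximum) auto
qed

lemma inner_le_lovasz:
  assumes "y \<in> base"
  shows "y \<bullet> x \<le> lovasz x"
proof -
  obtain b where b: "\<And>v. \<bar>x $ v\<bar> \<le> b" by (rule bounded_components [of x]) (rule that)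
  have "- b \<le> x $ v \<and> x $ v \<le> b" for v using b [of v] by arith
  then show ?thesis
    using inner_le_integral [OF assms, of "-b" x b] lovasz_eq_integral [of "-b" x b] by simp
qed

lemma lovasz_attained:
  obtains y where "y \<in> base" "y \<bullet> x = lovasz x"
proof -
  obtain b where b: "\<And>v. \<bar>x $ v\<bar> \<le> b" by (rule bounded_components [of x]) (rule that)
  have ab: "- b \<le> x $ v \<and> x $ v \<le> b" for v using b [of v] by arith
  obtain y where y: "y \<in> base" "\<And>t. (\<Sum>v\<in>superlevel x t. y $ v) = w (superlevel x t)"
    by (rule greedy_base [of x]) (rule that)
  have "((\<lambda>t. \<Sum>v\<in>superlevel x t. y $ v) has_integral y \<bullet> x) {-b..b}"
    using ab y(1) by (intro has_integral_superlevel_inner) (auto simp: base_UNIV)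
  then have "y \<bullet> x = lovasz x"
    by (simp add: y(2) integral_unique lovasz_eq_integral [OF ab])
  with y(1) show thesis by (rule that)
qed

lemma lovasz_nonneg: "0 \<le> lovasz x"
  using inner_le_lovasz [of 0 x] by (simp add: base_def nonneg)

lemma is_arg_max_iff_lovasz:
  fixes x :: "real ^ 'n"
  shows "is_arg_max (\<lambda>y. y \<bullet> x) (\<lambda>y. y \<in> base) y \<longleftrightarrow> y \<in> base \<and> y \<bullet> x = lovasz x"
proof -
  obtain y0 where y0: "y0 \<in> base" "y0 \<bullet> x = lovasz x"
    by (rule lovasz_attained)
  show ?thesis
  proof
    assume "is_arg_max (\<lambda>y. y \<bullet> x) (\<lambda>y. y \<in> base) y"
    then have "y \<in> base" "\<not> y0 \<bullet> x > y \<bullet> x"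
      using y0(1) by (auto simp: is_arg_max_def)
    then show "y \<in> base \<and> y \<bullet> x = lovasz x"
      using y0(2) inner_le_lovasz [of y x] by simp
  next
    assume "y \<in> base \<and> y \<bullet> x = lovasz x"
    then show "is_arg_max (\<lambda>y. y \<bullet> x) (\<lambda>y. y \<in> base) y"
      using inner_le_lovasz [of _ x] by (auto simp: is_arg_max_def not_less)
  qed
qed

lemma lovasz_uminus: "lovasz (- x) = lovasz x"
proof -
  have "lovasz (- x) \<le> lovasz x" for x :: "real ^ 'n"
  proof -
    obtain y where "y \<in> base" "y \<bullet> (- x) = lovasz (- x)"
      by (rule lovasz_attained)
    then show ?thesis using inner_le_lovasz [OF base_uminus, of y x] by simp
  qed
  from this [of x] this [of "- x"] show ?thesis by simp
qed

text \<open>At a maximizer y the gap w - y on superlevel sets is nonnegative with integral 0. For t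
  \<ge> 0 the superlevel set of xA is that of x cut down by the zero-weight set Z, and by
  \<open>split_zero\<close> this increases neither the weight nor the gap. Hence y remains a
  maximizer at xA.\<close>

lemma lovasz_restrict:
  assumes Z: "w Z = 0" and A: "{v. x $ v > 0} \<inter> Z = A" and y: "y \<in> base" "y \<bullet> x = lovasz x"
  defines "xA \<equiv> \<chi> v. if v \<in> A then x $ v else 0"
  shows "lovasz xA \<le> lovasz x" and "lovasz xA \<le> y \<bullet> xA"
proof -
  obtain b where b: "b \<ge> 0" "\<And>v. \<bar>x $ v\<bar> \<le> b" by (rule bounded_components [of x]) (rule that)
  have bx: "- b \<le> x $ v \<and> x $ v \<le> b" for v using b(2) [of v] by arith
  have A_pos: "x $ v > 0" if "v \<in> A" for v using A that by blast
  have bA: "0 \<le> xA $ v \<and> xA $ v \<le> b" for v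
    using A_pos [of v] bx [of v] b(1) by (auto simp: xA_def)
  have lev: "superlevel xA t = superlevel x t \<inter> Z" if "t \<ge> 0" for t
    using that by (auto simp: superlevel_def xA_def A [symmetric])
  let ?s = "\<lambda>t. \<Sum>v\<in>superlevel x t. y $ v" and ?sA = "\<lambda>t. \<Sum>v\<in>superlevel xA t. y $ v"
  let ?d = "\<lambda>t. w (superlevel x t) - ?s t" and ?dA = "\<lambda>t. w (superlevel xA t) - ?sA t"
  note int = integrable_on_superlevel_unweighted [of w]
  have wd: "?d integrable_on {c..d}" "?dA integrable_on {c..d}" for c d
    using integrable_on_superlevel_unweighted [of "\<lambda>S. w S - (\<Sum>v\<in>S. y $ v)"] by auto
  have intx: "integral {0..b} f \<le> integral {-b..b} f"
    if "f integrable_on {-b..b}" "\<And>t. t \<in> {-b..b} \<Longrightarrow> 0 \<le> f t" for f :: "real \<Rightarrow> real"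
    using that b(1) integrable_on_subinterval [OF that(1), of 0 b]
    by (intro integral_subset_le) auto
  have "lovasz xA = integral {0..b} (\<lambda>t. w (superlevel xA t))"
    by (rule lovasz_eq_integral [OF bA])
  also have "\<dots> \<le> integral {0..b} (\<lambda>t. w (superlevel x t))"
  proof (rule integral_le [OF int int])
    fix t assume "t \<in> {0..b}"
    then show "w (superlevel xA t) \<le> w (superlevel x t)"
      using split_zero [OF Z, of "superlevel x t"] nonneg [of "superlevel x t - Z"] lev [of t] by simp
  qed
  also have "\<dots> \<le> integral {-b..b} (\<lambda>t. w (superlevel x t))"
    by (rule intx [OF int nonneg])
  also have "\<dots> = lovasz x"
    by (rule lovasz_eq_integral [OF bx, symmetric])
  finally show "lovasz xA \<le> lovasz x" .
  have s: "(?s has_integral y \<bullet> x) {-b..b}"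
    using bx y(1) by (intro has_integral_superlevel_inner) (auto simp: base_UNIV)
  have sA: "(?sA has_integral y \<bullet> xA) {0..b}"
    using bA y(1) by (intro has_integral_superlevel_inner) (auto simp: base_UNIV)
  have "lovasz xA - y \<bullet> xA = integral {0..b} ?dA"
    using sA by (subst integral_diff) (auto simp: int lovasz_eq_integral [OF bA] integral_unique has_integral_integrable)
  also have "\<dots> \<le> integral {0..b} ?d"
  proof (rule integral_le [OF wd(2,1)])
    fix t assume "t \<in> {0..b}"
    then have l: "superlevel xA t = superlevel x t \<inter> Z" using lev by simp
    have "?s t = ?sA t + (\<Sum>v\<in>superlevel x t - Z. y $ v)"
      unfolding l by (rule sum.Int_Diff) simp
    then show "?dA t \<le> ?d t"
      using split_zero [OF Z, of "superlevel x t"] base_le [OF y(1), of "superlevel x t - Z"] l by simp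
  qed
  also have "\<dots> \<le> integral {-b..b} ?d"
    using base_le [OF y(1)] by (intro intx wd) simp
  also have "\<dots> = lovasz x - y \<bullet> x"
    using s by (subst integral_diff) (auto simp: int lovasz_eq_integral [OF bx] integral_unique has_integral_integrable)
  finally show "lovasz xA \<le> y \<bullet> xA"
    using y(2) by simp
qed

end


section \<open>Power inequalities\<close>

lemma powr_Young:
  fixes p r s :: real
  assumes "p \<ge> 1" "s \<ge> 0" "r \<ge> 0"
  shows "p * s powr (p - 1) * r \<le> (p - 1) * s powr p + r powr p"
proof (cases "p = 1")
  case True
  then show ?thesis using assms by (cases "s = 0") auto
next
  case False
  define q where "q = p / (p - 1)"
  have pq: "p > 1" "q > 1" "1/p + 1/q = 1" "(p - 1) * q = p"
    using assms False by (auto simp: q_def field_simps)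
  have "r * s powr (p - 1) \<le> r powr p / p + (s powr (p - 1)) powr q / q"
    by (rule Youngs_inequality) (use pq assms in auto)
  then have "p * (r * s powr (p - 1)) \<le> p * (r powr p / p + s powr p / q)"
    using pq assms by (intro mult_left_mono) (simp_all add: powr_powr)
  also have "\<dots> = r powr p + (p - 1) * s powr p"
    using pq(1) by (simp add: q_def field_simps)
  finally show ?thesis by (simp add: algebra_simps)
qed

text \<open>Young's inequality is summed after scaling f by a factor k that makes the two sums of
  p-th powers equal. Writing the second factor as g^(p - 1) includes p = 1; if one of the sums is 0,
  the convention \<open>0 powr 0 = 0\<close> keeps both sides at 0.\<close>

lemma weighted_Hoelder:
  fixes p :: real
  assumes "finite E" and p: "p \<ge> 1"
    and nonneg: "\<And>e. e \<in> E \<Longrightarrow> 0 \<le> \<theta> e \<and> 0 \<le> f e \<and> 0 \<le> g e"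
  shows "(\<Sum>e\<in>E. \<theta> e * (f e * g e powr (p - 1)))
      \<le> (\<Sum>e\<in>E. \<theta> e * f e powr p) powr (1 / p) * (\<Sum>e\<in>E. \<theta> e * g e powr p) powr ((p - 1) / p)"
    (is "?L \<le> ?F powr _ * ?G powr _")
proof (cases "?F = 0 \<or> ?G = 0")
  case True
  then have "\<theta> e * (f e * g e powr (p - 1)) = 0" if "e \<in> E" for e
    using that nonneg sum_nonneg_eq_0_iff [OF \<open>finite E\<close>, of "\<lambda>e. \<theta> e * f e powr p"]
      sum_nonneg_eq_0_iff [OF \<open>finite E\<close>, of "\<lambda>e. \<theta> e * g e powr p"] by auto
  then have "?L = 0" by (simp add: sum.neutral)
  then show ?thesis by simp
next
  case False
  have "?F \<ge> 0" "?G \<ge> 0" using nonneg by (auto intro!: sum_nonneg)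
  with False have pos: "?F > 0" "?G > 0" by linarith+
  define k where "k = (?G / ?F) powr (1 / p)"
  have k: "k > 0" "k powr p = ?G / ?F"
    using pos p by (auto simp: k_def powr_powr)
  have "p * k * ?L = (\<Sum>e\<in>E. \<theta> e * (p * g e powr (p - 1) * (k * f e)))"
    by (simp add: sum_distrib_left algebra_simps)
  also have "\<dots> \<le> (\<Sum>e\<in>E. \<theta> e * ((p - 1) * g e powr p + (k * f e) powr p))"
    using nonneg k p by (intro sum_mono mult_left_mono powr_Young) auto
  also have "\<dots> = (\<Sum>e\<in>E. (p - 1) * (\<theta> e * g e powr p) + (?G / ?F) * (\<theta> e * f e powr p))"
  proof (rule sum.cong [OF refl])
    fix e assume "e \<in> E"
    then have "(k * f e) powr p = (?G / ?F) * f e powr p"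
      using nonneg k by (simp add: powr_mult)
    then show "\<theta> e * ((p - 1) * g e powr p + (k * f e) powr p) = (p - 1) * (\<theta> e * g e powr p) + (?G / ?F) * (\<theta> e * f e powr p)"
      by (simp only:) (simp add: algebra_simps)
  qed
  also have "\<dots> = (p - 1) * ?G + (?G / ?F) * ?F"
    by (simp only: sum.distrib sum_distrib_left)
  also have "\<dots> = p * ?G"
    using pos by (simp add: algebra_simps)
  finally have "k * ?L \<le> ?G"
    using p by simp
  then have "?L \<le> ?G / k"
    using k(1) by (simp add: pos_le_divide_eq mult.commute)
  also have "\<dots> = ?F powr (1 / p) * (?G powr 1 / ?G powr (1 / p))"
    using pos by (simp add: k_def powr_divide)
  also have "?G powr 1 / ?G powr (1 / p) = ?G powr ((p - 1) / p)"
    using p by (simp only: powr_diff [symmetric]) (simp add: diff_divide_distrib)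
  finally show ?thesis .
qed

text \<open>Let R be the p-th power mean of m and M. Integrating Young's inequality p s^(p - 1) R
  \<le> (p - 1) s^p + R^p over [m, M] leaves the integral of s^p, which by the trapezoid rule for a
  convex function is at most (M - m) R^p. Both integrations appear as monotonicity of a
  primitive.\<close>

lemma powr_diff_le_trapezoid:
  fixes p m M :: real
  assumes p: "p \<ge> 1" and m: "0 \<le> m" "m \<le> M"
  shows "M powr p - m powr p \<le> p * (((M powr p + m powr p) / 2) powr (1 / p)) powr (p - 1) * (M - m)"
proof (cases "m = M")
  case False
  then have M: "m < M" "M > 0" using m by auto
  define R where "R = ((M powr p + m powr p) / 2) powr (1 / p)"
  have R: "R > 0" "R powr p = (M powr p + m powr p) / 2"
  proof -
    have "M powr p + m powr p > 0" using M by (intro add_pos_nonneg) auto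
    then show "R > 0" "R powr p = (M powr p + m powr p) / 2"
      using p by (auto simp: R_def powr_powr)
  qed
  have dp: "((\<lambda>s. s powr p) has_real_derivative p * s powr (p - 1)) (at s)"
    and dp1: "((\<lambda>s. s powr (p + 1) / (p + 1)) has_real_derivative s powr p) (at s)" if "s > 0" for s
    using that has_real_derivative_powr [of s p]
      DERIV_cdivide [OF has_real_derivative_powr [of s "p + 1"], of "p + 1"] p by simp_all
  \<comment> \<open>Up to a constant, the trapezoid over [m, s] minus the area under the p-th power;
    its derivative is nonnegative by Young's inequality with r = m.\<close>
  let ?G = "\<lambda>s. (s - m) * (s powr p + m powr p) / 2 - s powr (p + 1) / (p + 1)"
  have "?G m \<le> ?G M"
  proof (rule DERIV_nonneg_imp_increasing_open [OF m(2)])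
    fix s assume s: "m < s" "s < M"
    then have s0: "s > 0" using m by simp
    have "(?G has_real_derivative (s powr p + m powr p + (s - m) * (p * s powr (p - 1))) / 2 - s powr p) (at s)"
      by (intro DERIV_diff dp1 [OF s0] DERIV_cdivide
          DERIV_cong [OF DERIV_mult [OF DERIV_diff [OF DERIV_ident DERIV_const] DERIV_add [OF dp [OF s0] DERIV_const]]])
        (simp add: algebra_simps)
    moreover have "s powr (p - 1) * s = s powr p"
      using powr_mult_base [of s "p - 1"] s0 by (simp add: mult.commute)
    then have "(s powr p + m powr p + (s - m) * (p * s powr (p - 1))) / 2 - s powr p \<ge> 0"
      using powr_Young [of p s m] p s0 m by (simp add: algebra_simps)
    ultimately show "\<exists>y. (?G has_real_derivative y) (at s) \<and> y \<ge> 0" by blast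
  next
    show "continuous_on {m..M} ?G"
      using p m by (intro continuous_intros continuous_on_powr') auto
  qed
  then have G: "(M powr (p + 1) - m powr (p + 1)) / (p + 1) \<le> (M - m) * R powr p"
    by (simp only: R(2) diff_divide_distrib times_divide_eq_right diff_self mult_zero_left div_0)
  \<comment> \<open>A primitive of the gap in Young's inequality with r = R, divided by R.\<close>
  let ?F = "\<lambda>s. (p - 1) / R * (s powr (p + 1) / (p + 1)) + R powr (p - 1) * s - s powr p"
  have RR: "R powr (p - 1) * R = R powr p"
    using powr_mult_base [of R "p - 1"] R(1) by (simp add: mult.commute)
  have "?F m \<le> ?F M"
  proof (rule DERIV_nonneg_imp_increasing_open [OF m(2)])
    fix s assume s: "m < s" "s < M"
    then have s0: "s > 0" using m by simp
    have "(?F has_real_derivative (p - 1) / R * s powr p + R powr (p - 1) - p * s powr (p - 1)) (at s)"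
      by (intro DERIV_diff DERIV_add dp [OF s0] DERIV_cmult dp1 [OF s0]
          DERIV_cong [OF DERIV_cmult [OF DERIV_ident]]) simp
    moreover have "R * (p * s powr (p - 1)) \<le> R * ((p - 1) / R * s powr p + R powr (p - 1))"
    proof -
      have "R * ((p - 1) / R * s powr p + R powr (p - 1)) = R * ((p - 1) / R) * s powr p + R powr (p - 1) * R"
        by (simp only: distrib_left mult.assoc mult.commute mult.left_commute)
      also have "R * ((p - 1) / R) = p - 1"
        using R(1) by simp
      finally have "R * ((p - 1) / R * s powr p + R powr (p - 1)) = (p - 1) * s powr p + R powr p"
        by (simp only: RR)
      moreover have "R * (p * s powr (p - 1)) = p * s powr (p - 1) * R"
        by (rule mult.commute)
      moreover have "p * s powr (p - 1) * R \<le> (p - 1) * s powr p + R powr p"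
        using p s0 R(1) by (intro powr_Young) auto
      ultimately show ?thesis by linarith
    qed
    then have "p * s powr (p - 1) \<le> (p - 1) / R * s powr p + R powr (p - 1)"
      using R(1) by (simp only: mult_le_cancel_left_pos)
    then have "(p - 1) / R * s powr p + R powr (p - 1) - p * s powr (p - 1) \<ge> 0"
      by linarith
    ultimately show "\<exists>y. (?F has_real_derivative y) (at s) \<and> y \<ge> 0" by blast
  next
    have "continuous_on {m..M} (\<lambda>s. s powr q)" if "q > 0" for q
      using that m by (intro continuous_on_powr' continuous_intros) auto
    then show "continuous_on {m..M} ?F"
      using p by (intro continuous_on_diff continuous_on_add continuous_on_mult_left continuous_on_divide
          continuous_on_const continuous_on_id) auto
  qed
  then have "M powr p - m powr p \<le> (p - 1) / R * ((M powr (p + 1) - m powr (p + 1)) / (p + 1)) + R powr (p - 1) * (M - m)"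
    by (simp only: diff_divide_distrib right_diff_distrib)
  also have "\<dots> \<le> (p - 1) / R * ((M - m) * R powr p) + R powr (p - 1) * (M - m)"
    using G p R(1) by (intro add_right_mono mult_left_mono) auto
  also have "\<dots> = p * R powr (p - 1) * (M - m)"
  proof -
    have "(p - 1) / R * ((M - m) * R powr p) = (p - 1) * (M - m) * (R powr (p - 1) * R / R)"
      by (simp only: RR) simp
    also have "R powr (p - 1) * R / R = R powr (p - 1)"
      using R(1) by (intro nonzero_mult_div_cancel_right) simp
    finally have eq: "(p - 1) / R * ((M - m) * R powr p) = (p - 1) * (M - m) * R powr (p - 1)" .
    show ?thesis
      unfolding eq by (simp add: algebra_simps)
  qed
  finally show ?thesis by (simp only: R_def)
qed simp

section \<open>Estimates for the Lovasz extension on a single edge\<close>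

context symmetric_submodular
begin

text \<open>At a maximizer y the inner product is the sum of a i times y(S i), and the absolute
  value of y(S i) is at most w(S i). The sets may overlap.\<close>

lemma lovasz_indicator_sum_le:
  assumes x: "\<And>v. x $ v = (\<Sum>i\<in>I. if v \<in> S i then a i else 0)"
  shows "lovasz x \<le> (\<Sum>i\<in>I. \<bar>a i\<bar> * w (S i))"
proof -
  obtain y where y: "y \<in> base" "y \<bullet> x = lovasz x" by (rule lovasz_attained)
  have "y \<bullet> x = (\<Sum>v\<in>UNIV. \<Sum>i\<in>I. if v \<in> S i then a i * y $ v else 0)"
    by (auto simp: inner_vec_def x sum_distrib_left intro!: sum.cong)
  also have "\<dots> = (\<Sum>i\<in>I. \<Sum>v\<in>UNIV. if v \<in> S i then a i * y $ v else 0)"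
    by (rule sum.swap)
  also have "\<dots> = (\<Sum>i\<in>I. a i * (\<Sum>v\<in>S i. y $ v))"
    by (simp add: sum.If_cases sum_distrib_left)
  also have "\<dots> \<le> (\<Sum>i\<in>I. \<bar>a i\<bar> * w (S i))"
  proof (rule sum_mono)
    fix i
    have "a i * (\<Sum>v\<in>S i. y $ v) \<le> \<bar>a i\<bar> * \<bar>\<Sum>v\<in>S i. y $ v\<bar>"
      by (simp add: abs_mult [symmetric])
    also have "\<dots> \<le> \<bar>a i\<bar> * w (S i)"
      by (intro mult_left_mono base_abs_le y) auto
    finally show "a i * (\<Sum>v\<in>S i. y $ v) \<le> \<bar>a i\<bar> * w (S i)" .
  qed
  finally show ?thesis using y by simp
qed

lemma lovasz_le_norm1:
  assumes "\<And>S. w S \<le> 1"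
  shows "lovasz x \<le> (\<Sum>v\<in>UNIV. \<bar>x $ v\<bar>)"
proof -
  have "lovasz x \<le> (\<Sum>v\<in>UNIV. \<bar>x $ v\<bar> * w {v})"
    by (rule lovasz_indicator_sum_le) simp
  also have "\<dots> \<le> (\<Sum>v\<in>UNIV. \<bar>x $ v\<bar>)"
    using assms by (intro sum_mono mult_left_le) auto
  finally show ?thesis .
qed

text \<open>Levels above R contribute nothing, since there the superlevel set misses e; below R the
  density p t^(p - 1) is at most p R^(p - 1).\<close>

lemma power_integral_le:
  assumes p: "p \<ge> 1" and z: "\<And>v. 0 \<le> z $ v \<and> z $ v \<le> b"
    and local: "\<And>S. w S = w (S \<inter> e)" and R: "\<And>v. v \<in> e \<Longrightarrow> z $ v \<le> R"
  shows "integral {0..b} (\<lambda>t. p * t powr (p - 1) * w (superlevel z t)) \<le> p * R powr (p - 1) * lovasz z"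
proof -
  have "integral {0..b} (\<lambda>t. p * t powr (p - 1) * w (superlevel z t))
      \<le> integral {0..b} (\<lambda>t. p * R powr (p - 1) * w (superlevel z t))"
  proof (rule integral_le [OF integrable_on_superlevel_power [OF p] integrable_on_mult_right])
    show "(\<lambda>t. w (superlevel z t)) integrable_on {0..b}"
      by (rule integrable_on_superlevel_unweighted)
    fix t assume t: "t \<in> {0..b}"
    show "p * t powr (p - 1) * w (superlevel z t) \<le> p * R powr (p - 1) * w (superlevel z t)"
    proof (cases "t \<le> R")
      case True
      then show ?thesis
        using t p by (intro mult_right_mono mult_left_mono powr_mono2 nonneg) auto
    next
      case False
      then have "superlevel z t \<inter> e = {}"
        using R by (force simp: superlevel_def)
      then have "w (superlevel z t) = 0"
        using local [of "superlevel z t"] by simp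
      then show ?thesis by simp
    qed
  qed
  then show ?thesis
    by (simp add: lovasz_eq_integral [OF z])
qed

context
  fixes e :: "'n set"
  assumes full_cut: "\<And>S. w S = (if S \<inter> e = {} \<or> e \<subseteq> S then 0 else 1)"
begin

text \<open>Only the extreme values on e matter: a superlevel set cuts e exactly at the levels from
  the minimum, included, to the maximum, excluded.\<close>

lemma full_cut_superlevel:
  assumes "u \<in> e" "u' \<in> e" "\<And>v. v \<in> e \<Longrightarrow> z $ u' \<le> z $ v \<and> z $ v \<le> z $ u"
  shows "w (superlevel z t) = (if t < z $ u then 1 else 0) - (if t < z $ u' then 1 else 0)"
proof -
  have "superlevel z t \<inter> e = {} \<longleftrightarrow> \<not> t < z $ u"
    using assms by (force simp: superlevel_def)
  moreover have "e \<subseteq> superlevel z t \<longleftrightarrow> t < z $ u'"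
    using assms by (force simp: superlevel_def)
  moreover have "z $ u' \<le> z $ u"
    using assms by blast
  ultimately show ?thesis
    unfolding full_cut [of "superlevel z t"] by auto
qed

lemma full_cut_lovasz:
  assumes "u \<in> e" "u' \<in> e" "\<And>v. v \<in> e \<Longrightarrow> z $ u' \<le> z $ v \<and> z $ v \<le> z $ u"
  shows "lovasz z = z $ u - z $ u'"
proof -
  obtain b where b: "b \<ge> 0" "\<And>v. \<bar>z $ v\<bar> \<le> b" by (rule bounded_components [of z]) (rule that)
  have ab: "- b \<le> z $ v \<and> z $ v \<le> b" for v using b(2) [of v] by arith
  have 1: "((\<lambda>t. 1 * (if t < z $ v then 1 else 0 :: real)) has_integral z $ v - - b) {-b..b}" for v
    using ab [of v] has_integral_const_real [of "1::real" "-b" "z $ v"]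
    by (intro has_integral_below) auto
  have "((\<lambda>t. w (superlevel z t)) has_integral (z $ u - - b) - (z $ u' - - b)) {-b..b}"
    using has_integral_diff [OF 1 [of u] 1 [of u']] by (simp add: full_cut_superlevel [OF assms])
  then show ?thesis
    by (simp add: lovasz_eq_integral [OF ab] integral_unique)
qed

text \<open>The integral equals M^p - m^p for the extreme values M and m on e, so the trapezoid
  inequality applies and the height M is replaced by a power mean.\<close>

lemma full_cut_power_integral_le:
  assumes p: "p \<ge> 1" and z: "\<And>v. 0 \<le> z $ v \<and> z $ v \<le> b"
    and u: "u \<in> e" "u' \<in> e" "\<And>v. v \<in> e \<Longrightarrow> z $ u' \<le> z $ v \<and> z $ v \<le> z $ u"
  shows "integral {0..b} (\<lambda>t. p * t powr (p - 1) * w (superlevel z t))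
      \<le> p * (((z $ u powr p + z $ u' powr p) / 2) powr (1 / p)) powr (p - 1) * lovasz z"
proof -
  have 1: "((\<lambda>t. p * t powr (p - 1) * (if t < z $ v then 1 else 0)) has_integral z $ v powr p) {0..b}" for v
    using z [of v] p by (intro has_integral_below has_integral_power_derivative) auto
  have "((\<lambda>t. p * t powr (p - 1) * w (superlevel z t)) has_integral z $ u powr p - z $ u' powr p) {0..b}"
    using has_integral_diff [OF 1 [of u] 1 [of u']]
    by (simp only: full_cut_superlevel [OF u] right_diff_distrib)
  then have "integral {0..b} (\<lambda>t. p * t powr (p - 1) * w (superlevel z t)) = z $ u powr p - z $ u' powr p"
    by (rule integral_unique)
  also have "\<dots> \<le> p * (((z $ u powr p + z $ u' powr p) / 2) powr (1 / p)) powr (p - 1) * (z $ u - z $ u')"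
    using z u by (intro powr_diff_le_trapezoid p) auto
  finally show ?thesis
    by (simp add: full_cut_lovasz [OF u])
qed

end

end


section \<open>Cut functions and Cheeger constants of a submodular hypergraph\<close>

locale submodular_hg =
  fixes G :: "'n::finite hypergraph"
  assumes hg: "submodular_hypergraph G"
begin

lemma escale_pos: "e \<in> edges G \<Longrightarrow> escale G e > 0"
  and vweight_pos: "vweight G v > 0"
  and edges_nonempty: "edges G \<noteq> {}"
  using hg by (auto simp: submodular_hypergraph_def)

lemma
  assumes e: "e \<in> edges G"
  shows eweight_nonneg: "S \<subseteq> e \<Longrightarrow> 0 \<le> eweight G e S"
    and eweight_le_1: "S \<subseteq> e \<Longrightarrow> eweight G e S \<le> 1"
    and eweight_submodular: "S \<subseteq> e \<Longrightarrow> T \<subseteq> e \<Longrightarrow>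
      eweight G e (S \<union> T) + eweight G e (S \<inter> T) \<le> eweight G e S + eweight G e T"
    and eweight_empty: "eweight G e {} = 0"
    and eweight_diff: "S \<subseteq> e \<Longrightarrow> eweight G e (e - S) = eweight G e S"
    and Max_eweight: "Max (eweight G e ` Pow e) = 1"
  using bspec [OF hg [unfolded submodular_hypergraph_def, THEN conjunct2, THEN conjunct2] e] by metis+

lemma symmetric_submodular_cut_weight:
  assumes e: "e \<in> edges G"
  shows "symmetric_submodular (cut_weight G e)"
proof (rule symmetric_submodular.intro)
  fix S T
  show "0 \<le> cut_weight G e S"
    unfolding cut_weight_def by (rule eweight_nonneg [OF e]) simp
  have "(S \<union> T) \<inter> e = (S \<inter> e) \<union> (T \<inter> e)" "(S \<inter> T) \<inter> e = (S \<inter> e) \<inter> (T \<inter> e)" by auto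
  then show "cut_weight G e (S \<union> T) + cut_weight G e (S \<inter> T) \<le> cut_weight G e S + cut_weight G e T"
    using eweight_submodular [OF e, of "S \<inter> e" "T \<inter> e"] unfolding cut_weight_def by simp
  show "cut_weight G e {} = 0"
    by (simp add: cut_weight_def eweight_empty [OF e])
  have "- S \<inter> e = e - S \<inter> e" by auto
  then show "cut_weight G e (- S) = cut_weight G e S"
    using eweight_diff [OF e, of "S \<inter> e"] unfolding cut_weight_def by simp
qed

lemma cut_weight_le_1: "e \<in> edges G \<Longrightarrow> cut_weight G e S \<le> 1"
  by (simp add: cut_weight_def eweight_le_1)

lemma cut_weight_local: "cut_weight G e S = cut_weight G e (S \<inter> e)"
  by (simp add: cut_weight_def)

lemma base_polytope_eq: "e \<in> edges G \<Longrightarrow> base_polytope G e = symmetric_submodular.base (cut_weight G e)"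
  by (simp add: base_polytope_def symmetric_submodular.base_def [OF symmetric_submodular_cut_weight])

lemma lovasz_ext_eq: "e \<in> edges G \<Longrightarrow> lovasz_ext G e = symmetric_submodular.lovasz (cut_weight G e)"
  by (simp add: fun_eq_iff lovasz_ext_def base_polytope_eq
      symmetric_submodular.lovasz_def [OF symmetric_submodular_cut_weight])

lemma lovasz_subdiff_eq:
  assumes "e \<in> edges G"
  shows "y \<in> lovasz_subdiff G e x \<longleftrightarrow> y \<in> base_polytope G e \<and> y \<bullet> x = lovasz_ext G e x"
  using assms
  by (simp add: lovasz_subdiff_def base_polytope_eq lovasz_ext_eq
      symmetric_submodular.is_arg_max_iff_lovasz [OF symmetric_submodular_cut_weight])

lemma lovasz_ext_nonneg: "e \<in> edges G \<Longrightarrow> 0 \<le> lovasz_ext G e x"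
  by (simp add: lovasz_ext_eq symmetric_submodular.lovasz_nonneg [OF symmetric_submodular_cut_weight])

text \<open>With fewer vertices, the only subsets of e would be the empty set and e, both of weight
  0, against the normalization to maximum 1. The two vertices are what the homogeneous estimates
  compare.\<close>

lemma two_le_card_edge:
  assumes e: "e \<in> edges G"
  shows "2 \<le> card e"
proof (rule ccontr)
  assume "\<not> 2 \<le> card e"
  then have "card e = 0 \<or> card e = 1" by arith
  then have P: "Pow e = {{}, e}"
    by (auto simp: card_1_singleton_iff)
  have "eweight G e {} = 0" "eweight G e e = 0"
    using symmetric_submodular.UNIV_0 [OF symmetric_submodular_cut_weight [OF e]]
      symmetric_submodular.empty [OF symmetric_submodular_cut_weight [OF e]]
    by (simp_all add: cut_weight_def)
  then have "Max (eweight G e ` Pow e) = 0"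
    unfolding P by simp
  then show False
    using Max_eweight [OF e] by simp
qed

lemma degree_ratio_le: "Defs.degree G v \<le> max_degree_ratio G * vweight G v"
proof -
  have "Defs.degree G v / vweight G v \<le> max_degree_ratio G"
    unfolding max_degree_ratio_def by (rule Max_ge) auto
  then show ?thesis
    using vweight_pos [of v] by (simp add: pos_divide_le_eq)
qed

lemma max_degree_ratio_pos: "0 < max_degree_ratio G"
proof -
  obtain e where e: "e \<in> edges G" using edges_nonempty by blast
  then have "e \<noteq> {}" using two_le_card_edge [OF e] by auto
  then obtain v where v: "v \<in> e" by blast
  have "0 < Defs.degree G v"
    unfolding Defs.degree_def using e v escale_pos by (intro sum_pos) auto
  then have "0 < max_degree_ratio G * vweight G v"
    using degree_ratio_le [of v] by linarith
  then show ?thesis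
    using vweight_pos [of v] by (simp add: zero_less_mult_iff)
qed

lemma vol_pos: "S \<noteq> {} \<Longrightarrow> 0 < vol G S"
  unfolding vol_def using vweight_pos by (intro sum_pos) auto

lemma vol_nonneg: "0 \<le> vol G S"
  unfolding vol_def using vweight_pos by (intro sum_nonneg) (simp add: less_imp_le)

lemma boundary_vol_nonneg: "0 \<le> boundary_vol G S"
  unfolding boundary_vol_def using escale_pos symmetric_submodular.nonneg [OF symmetric_submodular_cut_weight]
  by (intro sum_nonneg mult_nonneg_nonneg) (auto simp: less_imp_le)

lemma boundary_vol_empty: "boundary_vol G {} = 0"
  unfolding boundary_vol_def using symmetric_submodular.empty [OF symmetric_submodular_cut_weight]
  by (simp add: sum.neutral)

lemma boundary_vol_Compl: "boundary_vol G (- S) = boundary_vol G S"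
  unfolding boundary_vol_def
  by (intro sum.cong refl) (simp add: symmetric_submodular.compl [OF symmetric_submodular_cut_weight])

lemma boundary_vol_Un: "boundary_vol G (S \<union> T) \<le> boundary_vol G S + boundary_vol G T"
  unfolding boundary_vol_def sum.distrib [symmetric] distrib_left [symmetric]
proof (intro sum_mono mult_left_mono)
  fix e assume e: "e \<in> edges G"
  show "cut_weight G e (S \<union> T) \<le> cut_weight G e S + cut_weight G e T"
    using symmetric_submodular.submodular [OF symmetric_submodular_cut_weight [OF e], of S T]
      symmetric_submodular.nonneg [OF symmetric_submodular_cut_weight [OF e], of "S \<inter> T"] by linarith
  show "0 \<le> escale G e" using escale_pos [OF e] by simp
qed

lemma boundary_vol_Union: "finite D \<Longrightarrow> boundary_vol G (\<Union>D) \<le> (\<Sum>S\<in>D. boundary_vol G S)"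
proof (induction D rule: finite_induct)
  case (insert S D)
  then show ?case using boundary_vol_Un [of S "\<Union>D"] by simp
qed (simp add: boundary_vol_empty)

lemma cheeger_ratio_nonneg: "0 \<le> cheeger_ratio G S"
  by (simp add: cheeger_ratio_def boundary_vol_nonneg vol_nonneg)

text \<open>The minimum in the denominator is at most \<open>vol G S\<close>. For S = V the
  conventional ratio 0 is consistent, because the boundary volume of V is 0.\<close>

lemma boundary_vol_le_cheeger_ratio:
  assumes "S \<noteq> {}"
  shows "boundary_vol G S \<le> cheeger_ratio G S * vol G S"
proof (cases "S = UNIV")
  case True
  then have "boundary_vol G S = 0"
    using boundary_vol_Compl [of "{}"] boundary_vol_empty by simp
  then show ?thesis
    using cheeger_ratio_nonneg vol_nonneg by (simp add: mult_nonneg_nonneg)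
next
  case False
  define m where "m = min (vol G S) (vol G (UNIV - S))"
  have "UNIV - S \<noteq> {}" using False by auto
  then have "0 < m"
    using assms vol_pos [of S] vol_pos [of "UNIV - S"] by (simp add: m_def)
  then have "boundary_vol G S = cheeger_ratio G S * m"
    using False by (simp add: cheeger_ratio_def flip: m_def)
  also have "\<dots> \<le> cheeger_ratio G S * vol G S"
    using cheeger_ratio_nonneg by (intro mult_left_mono) (auto simp: m_def)
  finally show ?thesis .
qed

section \<open>Cheeger constants through families of disjoint sets\<close>

lemma finite_disjoint_tuples: "finite (disjoint_tuples k :: 'n set list set)"
  by (rule finite_subset [OF _ finite_lists_length_eq [of UNIV k]]) (auto simp: disjoint_tuples_def)

text \<open>Passes from ordered tuples to plain sets of sets, which are easier to manipulate;
  disjoint nonempty sets are distinct, so nothing is lost.\<close>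

lemma disjoint_tuples_list_of_family:
  assumes D: "finite D" "\<And>S. S \<in> D \<Longrightarrow> S \<noteq> {}" "disjoint D"
  obtains Ss where "set Ss = D" "Ss \<in> disjoint_tuples (card D)"
proof -
  obtain Ss where Ss: "set Ss = D" "distinct Ss"
    using finite_distinct_list [OF D(1)] by blast
  have "Ss \<in> disjoint_tuples (card D)"
    unfolding disjoint_tuples_def
  proof (intro CollectI conjI allI impI)
    show "length Ss = card D" using Ss by (metis distinct_card)
    then show "Ss ! i \<noteq> {}" if "i < card D" for i
      using that D(2) Ss(1) by (metis nth_mem)
    fix i j assume ij: "i < card D" "j < card D" "i \<noteq> j"
    then have "Ss ! i \<in> D" "Ss ! j \<in> D" "Ss ! i \<noteq> Ss ! j"
      using Ss \<open>length Ss = card D\<close> by (auto simp: nth_eq_iff_index_eq)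
    then show "Ss ! i \<inter> Ss ! j = {}"
      using D(3) by (simp add: disjointD)
  qed
  with Ss(1) show thesis by (rule that)
qed

lemma cheeger_const_le_family:
  assumes D: "D \<noteq> {}" "\<And>S. S \<in> D \<Longrightarrow> S \<noteq> {}" "disjoint D"
    and le: "\<And>S. S \<in> D \<Longrightarrow> cheeger_ratio G S \<le> H"
  shows "cheeger_const G (card D) \<le> H"
proof -
  have "finite D" by simp
  then obtain Ss where Ss: "set Ss = D" "Ss \<in> disjoint_tuples (card D)"
    using disjoint_tuples_list_of_family D by metis
  have "cheeger_const G (card D) \<le> Max (cheeger_ratio G ` set Ss)"
    unfolding cheeger_const_def by (intro Min_le finite_imageI finite_disjoint_tuples imageI Ss)
  also have "\<dots> \<le> H"
    using D le Ss by (intro Max.boundedI) auto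
  finally show ?thesis .
qed

text \<open>The family D witnesses that tuples of this length exist, so that \<open>Min\<close>
  ranges over a nonempty set. Nonnegativity allows p-th powers to be taken in the lower
  bound.\<close>

lemma cheeger_const_nonneg:
  fixes D :: "'n set set"
  assumes D: "D \<noteq> {}" "\<And>S. S \<in> D \<Longrightarrow> S \<noteq> {}" "disjoint D"
  shows "0 \<le> cheeger_const G (card D)"
proof -
  have finD: "finite D" by simp
  have "disjoint_tuples (card D) \<noteq> ({} :: 'n set list set)"
    using disjoint_tuples_list_of_family [OF finD D(2,3)] by auto
  then have "cheeger_const G (card D) \<in> (\<lambda>Ss. Max (cheeger_ratio G ` set Ss)) ` disjoint_tuples (card D)"
    unfolding cheeger_const_def by (intro Min_in finite_imageI finite_disjoint_tuples) auto
  then obtain Ss where Ss: "Ss \<in> disjoint_tuples (card D)" "cheeger_const G (card D) = Max (cheeger_ratio G ` set Ss)"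
    by blast
  have "length Ss = card D" "card D \<noteq> 0"
    using Ss(1) D(1) finD by (auto simp: disjoint_tuples_def)
  then obtain S where "S \<in> set Ss"
    by (cases Ss) auto
  then have "cheeger_ratio G S \<le> cheeger_const G (card D)"
    unfolding Ss(2) by (intro Max_ge) auto
  then show ?thesis
    using cheeger_ratio_nonneg [of S] by linarith
qed

lemma cheeger_const_attained:
  assumes k: "1 \<le> k" "k \<le> CARD('n)"
  obtains Ss where "Ss \<in> disjoint_tuples k" "\<And>i. i < k \<Longrightarrow> cheeger_ratio G (Ss ! i) \<le> cheeger_const G k"
proof -
  \<comment> \<open>Singletons show that the minimum is over a nonempty set of tuples.\<close>
  obtain V :: "'n set" where V: "card V = k"
    using k by (metis obtain_subset_with_card_n)
  have "finite ((\<lambda>v. {v}) ` V)" "card ((\<lambda>v. {v}) ` V) = k"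
    using V by (auto simp: card_image)
  then have "disjoint_tuples k \<noteq> ({} :: 'n set list set)"
    using disjoint_tuples_list_of_family [of "(\<lambda>v. {v}) ` V"] by (auto simp: disjoint_def)
  then have "cheeger_const G k \<in> (\<lambda>Ss. Max (cheeger_ratio G ` set Ss)) ` disjoint_tuples k"
    unfolding cheeger_const_def by (intro Min_in finite_imageI finite_disjoint_tuples) auto
  then obtain Ss where Ss: "Ss \<in> disjoint_tuples k" "cheeger_const G k = Max (cheeger_ratio G ` set Ss)"
    by blast
  then have le: "cheeger_ratio G (Ss ! i) \<le> cheeger_const G k" if "i < k" for i
    using that by (auto simp: disjoint_tuples_def intro!: Max_ge)
  with Ss(1) show thesis by (rule that)
qed

text \<open>A set of more than half the volume is replaced by the complement of the union of the others:
  by subadditivity of the boundary volume, the bound for the others passes to it.\<close>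

lemma cheeger_const_le:
  assumes D: "D \<noteq> {}" "\<And>S. S \<in> D \<Longrightarrow> S \<noteq> {}" "disjoint D"
    and le: "\<And>S. S \<in> D \<Longrightarrow> boundary_vol G S \<le> H * vol G S"
  shows "cheeger_const G (card D) \<le> H"
proof -
  have finD: "finite D" by simp
  \<comment> \<open>The whole vertex set may occur as a member, with ratio 0 by convention, so H has
    to be nonnegative.\<close>
  have H: "H \<ge> 0"
  proof -
    obtain S where "S \<in> D" using D(1) by blast
    then have "0 \<le> H * vol G S" "vol G S > 0"
      using le [of S] boundary_vol_nonneg [of S] D(2) vol_pos [of S] by auto
    then show ?thesis by (simp add: zero_le_mult_iff)
  qed
  have small: "cheeger_ratio G S \<le> H"
    if "S \<noteq> {}" "boundary_vol G S \<le> H * min (vol G S) (vol G (UNIV - S))" for S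
  proof (cases "S = UNIV")
    case False
    define m where "m = min (vol G S) (vol G (UNIV - S))"
    have "UNIV - S \<noteq> {}" using False by auto
    then have "0 < m"
      using that(1) vol_pos [of S] vol_pos [of "UNIV - S"] by (simp add: m_def)
    then show ?thesis
      using that(2) False by (simp add: cheeger_ratio_def pos_divide_le_eq flip: m_def)
  qed (simp add: cheeger_ratio_def H)
  show ?thesis
  proof (cases "\<exists>S\<in>D. vol G (UNIV - S) < vol G S")
    case False
    then show ?thesis
      using D le by (intro cheeger_const_le_family small) (auto simp: not_less min_absorb1)
  next
    case True
    then obtain S where S: "S \<in> D" "vol G (UNIV - S) < vol G S" by blast
    define D' where "D' = D - {S}"
    \<comment> \<open>T absorbs S and all vertices outside the family, so the number of sets is
      kept; T is everything if S was the only set.\<close>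
    define T where "T = - \<Union>D'"
    have ST: "S \<subseteq> T"
      using disjointD [OF D(3) S(1)] by (force simp: T_def D'_def)
    have "T \<noteq> {}" using ST D(2) S(1) by auto
    have disT: "R \<inter> T = {}" if "R \<in> D'" for R
      using that by (auto simp: T_def)
    have "T \<notin> D'" using disT \<open>T \<noteq> {}\<close> by blast
    then have card: "card (insert T D') = card D"
      using card_Suc_Diff1 [OF finD S(1)] by (simp add: D'_def)
    have volUn: "vol G (\<Union>D') = (\<Sum>R\<in>D'. vol G R)"
    proof -
      have "R \<inter> R' = {}" if "R \<in> D'" "R' \<in> D'" "R \<noteq> R'" for R R'
        using that D(3) by (simp add: D'_def disjointD)
      then show ?thesis
        unfolding vol_def by (simp add: sum.Union_disjoint)
    qed
    have "cheeger_ratio G R \<le> H" if R: "R \<in> insert T D'" for R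
    proof (cases "R = T")
      case True
      have "boundary_vol G T \<le> (\<Sum>R\<in>D'. boundary_vol G R)"
        using boundary_vol_Union [of D'] by (simp add: T_def boundary_vol_Compl)
      also have "\<dots> \<le> (\<Sum>R\<in>D'. H * vol G R)"
        using le by (intro sum_mono) (simp add: D'_def)
      also have "\<dots> = H * vol G (UNIV - T)"
        by (simp add: volUn T_def sum_distrib_left Compl_eq_Diff_UNIV [symmetric])
      also have "vol G (UNIV - T) = min (vol G T) (vol G (UNIV - T))"
      proof -
        have "vol G (UNIV - T) \<le> vol G (UNIV - S)" "vol G S \<le> vol G T"
          unfolding vol_def using ST vweight_pos by (auto intro!: sum_mono2 simp: less_imp_le)
        then show ?thesis using S(2) by simp
      qed
      finally show ?thesis
        using small [OF \<open>T \<noteq> {}\<close>] True by simp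
    next
      case False
      then have RD: "R \<in> D" "R \<noteq> S" using R by (auto simp: D'_def)
      \<comment> \<open>The other sets lie in the complement of S and have less than half of the
        volume.\<close>
      then have "R \<subseteq> UNIV - S" "S \<subseteq> UNIV - R"
        using disjointD [OF D(3) S(1), of R] by auto
      then have "vol G R \<le> vol G (UNIV - S)" "vol G S \<le> vol G (UNIV - R)"
        unfolding vol_def using vweight_pos by (auto intro!: sum_mono2 simp: less_imp_le)
      then have "min (vol G R) (vol G (UNIV - R)) = vol G R"
        using S(2) by simp
      then show ?thesis
        using small [of R] D(2) le RD by simp
    qed
    moreover have "disjoint (insert T D')"
      using D(3) disT by (auto simp: disjoint_def D'_def)
    moreover have "R \<noteq> {}" if "R \<in> insert T D'" for R
      using that D(2) \<open>T \<noteq> {}\<close> by (auto simp: D'_def)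
    ultimately have "cheeger_const G (card (insert T D')) \<le> H"
      by (intro cheeger_const_le_family) auto
    then show ?thesis by (simp only: card)
  qed
qed

end


section \<open>Nodal domains and the lower bound\<close>

context submodular_hg
begin

lemma strongly_adjacent_sym:
  assumes "strongly_adjacent G u v"
  shows "strongly_adjacent G v u"
proof -
  obtain e where e: "e \<in> edges G" "u \<in> e" "v \<in> e"
    and pos: "\<And>S. S \<subseteq> e \<Longrightarrow> u \<in> S \<Longrightarrow> v \<notin> S \<Longrightarrow> cut_weight G e S > 0"
    using assms by (auto simp: strongly_adjacent_def)
  have "cut_weight G e S > 0" if S: "S \<subseteq> e" "v \<in> S" "u \<notin> S" for S
  proof -
    have "cut_weight G e (e - S) > 0"
      using S e by (intro pos) auto
    also have "cut_weight G e (e - S) = cut_weight G e S"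
      using eweight_diff [OF e(1) S(1)] S(1) by (simp add: cut_weight_def Int_absorb2)
    finally show ?thesis .
  qed
  then show ?thesis
    using e by (auto simp: strongly_adjacent_def)
qed

lemma adj_components:
  assumes A: "A \<in> adj_components G C"
  shows "A \<noteq> {}" "A \<subseteq> C" "\<And>u v. \<lbrakk>u \<in> A; v \<in> C - A\<rbrakk> \<Longrightarrow> \<not> strongly_adjacent G u v"
proof -
  let ?r = "{(u, v). u \<in> C \<and> v \<in> C \<and> strongly_adjacent G u v}"
  obtain a where a: "a \<in> C" "A = ?r\<^sup>* `` {a}"
    using A by (auto simp: adj_components_def elim: quotientE)
  show "A \<noteq> {}" using a by auto
  show AC: "A \<subseteq> C"
  proof
    fix b assume "b \<in> A"
    then have "(a, b) \<in> ?r\<^sup>*" using a by simp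
    then show "b \<in> C" using a(1) by cases auto
  qed
  show "\<not> strongly_adjacent G u v" if "u \<in> A" "v \<in> C - A" for u v
  proof
    assume "strongly_adjacent G u v"
    then have "(u, v) \<in> ?r" using that AC by auto
    moreover have "(a, u) \<in> ?r\<^sup>*" using that a by simp
    ultimately have "(a, v) \<in> ?r\<^sup>*" by (rule rtrancl_into_rtrancl [rotated])
    then show False using that a by simp
  qed
qed

lemma disjoint_adj_components: "disjoint (adj_components G C)"
proof -
  let ?r = "{(u, v). u \<in> C \<and> v \<in> C \<and> strongly_adjacent G u v}"
  have "sym ?r"
    using strongly_adjacent_sym by (auto simp: sym_def)
  then have "equiv UNIV (?r\<^sup>*)"
    by (intro equivI sym_rtrancl refl_rtrancl trans_rtrancl) simp_all
  then have "disjoint (UNIV // ?r\<^sup>*)"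
    by (intro disjointI) (drule (2) quotient_disj, simp)
  then show ?thesis
    by (rule pairwise_subset) (auto simp: adj_components_def quotient_def)
qed

lemma disjoint_strong_nodal_domains: "disjoint (strong_nodal_domains G x)"
proof -
  have "R \<inter> S = {}" if "R \<in> adj_components G {v. x $ v > 0}" "S \<in> adj_components G {v. x $ v < 0}" for R S
    using adj_components(2) [OF that(1)] adj_components(2) [OF that(2)] by fastforce
  then show ?thesis
    unfolding strong_nodal_domains_def
    using disjoint_adj_components [of "{v. x $ v > 0}"] disjoint_adj_components [of "{v. x $ v < 0}"]
    by (intro disjoint_union) auto
qed

lemma strong_nodal_domains_nonempty:
  assumes "x \<noteq> 0"
  shows "strong_nodal_domains G x \<noteq> {}"
proof -
  obtain v where "x $ v \<noteq> 0" using assms by (auto simp: vec_eq_iff)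
  then have "v \<in> {v. x $ v > 0} \<or> v \<in> {v. x $ v < 0}" by auto
  then show ?thesis
    unfolding strong_nodal_domains_def adj_components_def by (auto simp: quotient_def)
qed

text \<open>Non-adjacency of u and v yields a zero-weight set containing u but not v. Zero-weight
  sets are closed under unions and intersections, so the union over u of the intersections over v
  separates A from the rest of C inside e; empty index sets are harmless since the empty set and V
  have weight 0.\<close>

lemma nodal_zero_set:
  assumes e: "e \<in> edges G" and AC: "A \<subseteq> C"
    and nonadj: "\<And>u v. \<lbrakk>u \<in> A; v \<in> C - A\<rbrakk> \<Longrightarrow> \<not> strongly_adjacent G u v"
  obtains Z where "cut_weight G e Z = 0" "C \<inter> Z = A"
proof -
  interpret symmetric_submodular "cut_weight G e"
    by (rule symmetric_submodular_cut_weight [OF e])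
  have "\<exists>S. u \<in> S \<and> v \<notin> S \<and> cut_weight G e S = 0" if uv: "u \<in> A \<inter> e" "v \<in> (C - A) \<inter> e" for u v
  proof -
    have "\<not> strongly_adjacent G u v" using nonadj uv by auto
    then obtain S where "u \<in> S" "v \<notin> S" "\<not> cut_weight G e S > 0"
      using e uv unfolding strongly_adjacent_def by auto
    then show ?thesis
      using nonneg [of S] by (intro exI [of _ S]) auto
  qed
  then obtain F where F: "\<And>u v. u \<in> A \<inter> e \<Longrightarrow> v \<in> (C - A) \<inter> e \<Longrightarrow> u \<in> F u v \<and> v \<notin> F u v \<and> cut_weight G e (F u v) = 0"
    by metis
  define Z0 where "Z0 = (\<Union>u\<in>A \<inter> e. \<Inter>v\<in>(C - A) \<inter> e. F u v)"
  have "cut_weight G e Z0 = 0"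
    unfolding Z0_def using F by (intro zero_UN zero_INT) auto
  \<comment> \<open>Membership outside e does not affect \<open>cut_weight\<close>, so there the set
    is made to agree with A.\<close>
  moreover have "((Z0 \<inter> e) \<union> (A - e)) \<inter> e = Z0 \<inter> e" by blast
  ultimately have "cut_weight G e ((Z0 \<inter> e) \<union> (A - e)) = 0"
    by (simp add: cut_weight_def)
  moreover have "v \<in> (Z0 \<inter> e) \<union> (A - e) \<longleftrightarrow> v \<in> A" if "v \<in> C" for v
  proof (cases "v \<in> e")
    case True
    then show ?thesis
      using F that unfolding Z0_def by auto
  qed simp
  then have "C \<inter> ((Z0 \<inter> e) \<union> (A - e)) = A"
    using AC by blast
  ultimately show thesis by (rule that)
qed

text \<open>Selects one subgradient per edge from the Minkowski sum. Of the duality map only the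
  identity for \<open>z $ v * x $ v\<close> is retained: it holds whatever element of
  \<open>sgn_set 0\<close> is chosen at zero entries, and it treats p = 1 like the other
  exponents.\<close>

lemma eigenpair_cases:
  assumes eig: "eigenpair G p l x" and p: "p \<ge> 1"
  obtains y z where
    "\<And>e. e \<in> edges G \<Longrightarrow> y e \<in> base_polytope G e \<and> y e \<bullet> x = lovasz_ext G e x"
    "\<And>v. (\<Sum>e\<in>edges G. escale G e * (if p = 1 then 1 else lovasz_ext G e x powr (p - 1)) * y e $ v)
      = l * (vweight G v * z $ v)"
    "\<And>v. z $ v * x $ v = \<bar>x $ v\<bar> powr p"
proof -
  define c where "c = (\<lambda>e. escale G e * (if p = 1 then 1 else lovasz_ext G e x powr (p - 1)))"
  have "p_laplacian G p x = (\<Sum>e\<in>edges G. (\<lambda>y. c e *\<^sub>R y) ` lovasz_subdiff G e x)"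
    by (simp add: p_laplacian_def c_def)
  then obtain z where z: "z \<in> p_duality p x"
    and mem: "l *\<^sub>R (\<chi> v. vweight G v * z $ v) \<in> (\<Sum>e\<in>edges G. (\<lambda>y. c e *\<^sub>R y) ` lovasz_subdiff G e x)"
    using eig by (auto simp: eigenpair_def)
  then obtain s where s: "l *\<^sub>R (\<chi> v. vweight G v * z $ v) = (\<Sum>e\<in>edges G. s e)"
    "\<And>e. e \<in> edges G \<Longrightarrow> s e \<in> (\<lambda>y. c e *\<^sub>R y) ` lovasz_subdiff G e x"
    by (auto simp: set_sum_alt)
  then have "\<exists>y. y \<in> lovasz_subdiff G e x \<and> s e = c e *\<^sub>R y" if "e \<in> edges G" for e
    using that by blast
  then obtain y where y: "\<And>e. e \<in> edges G \<Longrightarrow> y e \<in> lovasz_subdiff G e x \<and> s e = c e *\<^sub>R y e"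
    by metis
  show thesis
  proof (rule that [of y z])
    show "y e \<in> base_polytope G e \<and> y e \<bullet> x = lovasz_ext G e x" if "e \<in> edges G" for e
      using y [OF that] by (simp add: lovasz_subdiff_eq that)
    fix v
    have "(\<Sum>e\<in>edges G. c e * y e $ v) = (\<Sum>e\<in>edges G. s e) $ v"
      using y by (simp add: sum_component)
    also have "\<dots> = l * (vweight G v * z $ v)"
      by (simp flip: s(1))
    finally show "(\<Sum>e\<in>edges G. escale G e * (if p = 1 then 1 else lovasz_ext G e x powr (p - 1)) * y e $ v)
      = l * (vweight G v * z $ v)"
      by (simp only: c_def)
    have sgn: "s * a = \<bar>a\<bar>" if "s \<in> sgn_set a" for s a
      using that by (auto simp: sgn_set_def split: if_splits)
    have zv: "z $ v \<in> (if p = 1 then sgn_set (x $ v) else (\<lambda>s. \<bar>x $ v\<bar> powr (p - 1) * s) ` sgn_set (x $ v))"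
      using z by (simp add: p_duality_def)
    show "z $ v * x $ v = \<bar>x $ v\<bar> powr p"
    proof (cases "p = 1")
      case True
      then show ?thesis using zv sgn by simp
    next
      case False
      then obtain s where "s \<in> sgn_set (x $ v)" "z $ v = \<bar>x $ v\<bar> powr (p - 1) * s"
        using zv by auto
      then have "z $ v * x $ v = \<bar>x $ v\<bar> * \<bar>x $ v\<bar> powr (p - 1)"
        using sgn [of s "x $ v"] by simp
      then show ?thesis
        by (simp add: powr_mult_base)
    qed
  qed
qed

lemma energy_nonneg: "0 \<le> energy G p x"
  unfolding energy_def using escale_pos by (intro sum_nonneg) (simp add: less_imp_le)

text \<open>The eigenvector equation is paired with xA. On each edge f_e(xA)^p \<le> f_e(x)^(p - 1)
  (y_e \<bullet> xA), because restriction does not increase f_e and f_e(xA) is at most the pairing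
  with y_e.\<close>

lemma energy_restrict_le:
  assumes p: "p \<ge> 1"
    and y: "\<And>e. e \<in> edges G \<Longrightarrow> y e \<in> base_polytope G e \<and> y e \<bullet> x = lovasz_ext G e x"
    and eq: "\<And>v. (\<Sum>e\<in>edges G. escale G e * (if p = 1 then 1 else lovasz_ext G e x powr (p - 1)) * y e $ v)
      = l * (vweight G v * z $ v)"
    and z: "\<And>v. z $ v * x $ v = \<bar>x $ v\<bar> powr p"
    and A: "A \<subseteq> {v. x $ v > 0}"
      "\<And>u v. \<lbrakk>u \<in> A; v \<in> {v. x $ v > 0} - A\<rbrakk> \<Longrightarrow> \<not> strongly_adjacent G u v"
  defines "xA \<equiv> \<chi> v. if v \<in> A then x $ v else 0"
  shows "energy G p xA \<le> l * (\<Sum>v\<in>UNIV. vweight G v * xA $ v powr p)"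
proof -
  define c where "c = (\<lambda>e. escale G e * (if p = 1 then 1 else lovasz_ext G e x powr (p - 1)))"
  have "energy G p xA \<le> (\<Sum>e\<in>edges G. c e * (y e \<bullet> xA))"
    unfolding energy_def
  proof (rule sum_mono)
    fix e assume e: "e \<in> edges G"
    interpret symmetric_submodular "cut_weight G e"
      by (rule symmetric_submodular_cut_weight [OF e])
    obtain Z where Z: "cut_weight G e Z = 0" "{v. x $ v > 0} \<inter> Z = A"
      using nodal_zero_set [OF e A] by blast
    have ye: "y e \<in> base" "y e \<bullet> x = lovasz x"
      using y [OF e] by (simp_all add: base_polytope_eq [OF e] lovasz_ext_eq [OF e])
    have le: "lovasz_ext G e xA \<le> lovasz_ext G e x" "lovasz_ext G e xA \<le> y e \<bullet> xA"
      unfolding lovasz_ext_eq [OF e] xA_def by (rule lovasz_restrict [OF Z ye])+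
    have nn: "0 \<le> lovasz_ext G e xA" by (rule lovasz_ext_nonneg [OF e])
    have "lovasz_ext G e xA powr p = lovasz_ext G e xA powr (p - 1) * lovasz_ext G e xA"
      using powr_mult_base [OF nn, of "p - 1"] by (simp add: mult.commute)
    also have "\<dots> \<le> (if p = 1 then 1 else lovasz_ext G e x powr (p - 1)) * (y e \<bullet> xA)"
    proof (rule mult_mono)
      \<comment> \<open>For p = 1 the left side is 0 or 1, depending on whether the base
        vanishes.\<close>
      show "lovasz_ext G e xA powr (p - 1) \<le> (if p = 1 then 1 else lovasz_ext G e x powr (p - 1))"
        using p le(1) nn by (auto intro: powr_mono2)
    qed (use le nn in auto)
    finally have "escale G e * lovasz_ext G e xA powr p
        \<le> escale G e * ((if p = 1 then 1 else lovasz_ext G e x powr (p - 1)) * (y e \<bullet> xA))"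
      using escale_pos [OF e] by (intro mult_left_mono) auto
    then show "escale G e * lovasz_ext G e xA powr p \<le> c e * (y e \<bullet> xA)"
      by (simp only: c_def mult.assoc)
  qed
  also have "\<dots> = (\<Sum>v\<in>UNIV. (\<Sum>e\<in>edges G. c e * y e $ v) * xA $ v)"
    unfolding inner_vec_def inner_real_def sum_distrib_left sum_distrib_right
    by (subst sum.swap) (simp only: mult.assoc)
  also have "\<dots> = (\<Sum>v\<in>UNIV. l * (vweight G v * z $ v) * xA $ v)"
    by (simp only: c_def eq)
  also have "\<dots> = (\<Sum>v\<in>UNIV. l * (vweight G v * xA $ v powr p))"
  proof (rule sum.cong [OF refl])
    fix v
    have "z $ v * xA $ v = xA $ v powr p"
    proof (cases "v \<in> A")
      case True
      then have "x $ v > 0" using A(1) by auto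
      then show ?thesis using z [of v] True by (simp add: xA_def)
    qed (simp add: xA_def)
    then show "l * (vweight G v * z $ v) * xA $ v = l * (vweight G v * xA $ v powr p)"
      by (simp only: mult.assoc)
  qed
  finally show ?thesis
    by (simp only: sum_distrib_left)
qed

text \<open>Let h be the least ratio of boundary volume to volume among nonempty subsets of A. All
  superlevel sets at t \<ge> 0 lie in A, so integrating h vol \<le> boundary volume bounds h N, with
  N the weighted sum of z^p. The edge heights R and Hoelder bound the other side by a multiple of
  N^(1/p) N^((p - 1)/p) = N, which cancels; the minimizing set is the one sought.\<close>

lemma sweep_cut:
  assumes p: "p \<ge> 1" and l: "l \<ge> 0" and \<kappa>: "\<kappa> \<ge> 0"
    and A: "A \<noteq> {}" "\<And>v. v \<in> A \<Longrightarrow> z $ v > 0" "\<And>v. v \<notin> A \<Longrightarrow> z $ v = 0"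
    and energy: "energy G p z \<le> l * (\<Sum>v\<in>UNIV. vweight G v * z $ v powr p)"
    and local: "\<And>e b. \<lbrakk>e \<in> edges G; \<And>v. 0 \<le> z $ v \<and> z $ v \<le> b\<rbrakk> \<Longrightarrow>
      \<exists>R\<ge>0. integral {0..b} (\<lambda>t. p * t powr (p - 1) * cut_weight G e (superlevel z t))
            \<le> p * R powr (p - 1) * lovasz_ext G e z \<and> R powr p \<le> \<kappa> * (\<Sum>v\<in>e. z $ v powr p)"
  obtains S where "S \<noteq> {}" "S \<subseteq> A"
    "boundary_vol G S \<le> p * (l powr (1 / p) * (\<kappa> * max_degree_ratio G) powr ((p - 1) / p)) * vol G S"
proof -
  define P where "P = {S. S \<noteq> {} \<and> S \<subseteq> A}"
  define h where "h = Min ((\<lambda>S. boundary_vol G S / vol G S) ` P)"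
  have "A \<in> P" using A by (simp add: P_def)
  then have "h \<in> (\<lambda>S. boundary_vol G S / vol G S) ` P"
    unfolding h_def by (intro Min_in) auto
  then obtain S where S: "S \<in> P" "h = boundary_vol G S / vol G S" by blast
  have h_le: "h * vol G T \<le> boundary_vol G T" if "T \<in> P" for T
  proof -
    have "h \<le> boundary_vol G T / vol G T"
      unfolding h_def using that by (intro Min_le) auto
    then show ?thesis
      using that vol_pos [of T] by (simp add: P_def pos_le_divide_eq)
  qed
  obtain b where b: "b \<ge> 0" "\<And>v. \<bar>z $ v\<bar> \<le> b" by (rule bounded_components [of z]) (rule that)
  have zb: "0 \<le> z $ v \<and> z $ v \<le> b" for v
    using A(2,3) [of v] b(2) [of v] by (cases "v \<in> A") auto
  define N where "N = (\<Sum>v\<in>UNIV. vweight G v * z $ v powr p)"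
  have N: "N > 0"
  proof -
    obtain v where "v \<in> A" using A(1) by blast
    then have "z $ v > 0" by (rule A(2))
    then have "0 < vweight G v * z $ v powr p"
      using vweight_pos [of v] by simp
    moreover have "0 \<le> vweight G u * z $ u powr p" for u
      using vweight_pos [of u] by simp
    ultimately show ?thesis
      unfolding N_def by (intro sum_pos2 [of _ v]) simp_all
  qed
  define J where "J = (\<lambda>e. integral {0..b} (\<lambda>t. p * t powr (p - 1) * cut_weight G e (superlevel z t)))"
  have "\<forall>e\<in>edges G. \<exists>R. R \<ge> 0 \<and> J e \<le> p * R powr (p - 1) * lovasz_ext G e z \<and> R powr p \<le> \<kappa> * (\<Sum>v\<in>e. z $ v powr p)"
    using local [OF _ zb] unfolding J_def by blast
  then obtain R where R: "\<And>e. e \<in> edges G \<Longrightarrow> R e \<ge> 0"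
    "\<And>e. e \<in> edges G \<Longrightarrow> J e \<le> p * R e powr (p - 1) * lovasz_ext G e z"
    "\<And>e. e \<in> edges G \<Longrightarrow> R e powr p \<le> \<kappa> * (\<Sum>v\<in>e. z $ v powr p)"
    unfolding bchoice_iff by blast
  have int: "(\<lambda>t. p * t powr (p - 1) * g (superlevel z t)) integrable_on {0..b}" for g
    by (rule integrable_on_superlevel_power [OF p])
  have "((\<lambda>t. p * t powr (p - 1) * sum (\<lambda>v. h * vweight G v) (superlevel z t)) has_integral
      (\<Sum>v\<in>UNIV. h * vweight G v * z $ v powr p)) {0..b}"
    using p zb by (intro has_integral_superlevel_sum has_integral_power_derivative) auto
  moreover have "(\<Sum>v\<in>UNIV. h * vweight G v * z $ v powr p) = h * N"
    by (simp only: N_def sum_distrib_left mult.assoc)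
  ultimately have "h * N = integral {0..b} (\<lambda>t. p * t powr (p - 1) * (h * vol G (superlevel z t)))"
    by (simp only: vol_def sum_distrib_left) (simp add: integral_unique)
  also have "\<dots> \<le> integral {0..b} (\<lambda>t. p * t powr (p - 1) * boundary_vol G (superlevel z t))"
  proof (rule integral_le [OF int int])
    fix t assume t: "t \<in> {0..b}"
    have sub: "superlevel z t \<subseteq> A"
    proof
      fix v assume "v \<in> superlevel z t"
      then have "z $ v > 0" using t by (simp add: superlevel_def)
      then show "v \<in> A" using A(3) [of v] by (cases "v \<in> A") auto
    qed
    have "h * vol G (superlevel z t) \<le> boundary_vol G (superlevel z t)"
    proof (cases "superlevel z t = {}")
      case True
      then show ?thesis by (simp add: vol_def boundary_vol_empty)
    next
      case False
      then show ?thesis using sub by (intro h_le) (simp add: P_def)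
    qed
    then show "p * t powr (p - 1) * (h * vol G (superlevel z t)) \<le> p * t powr (p - 1) * boundary_vol G (superlevel z t)"
      using p by (intro mult_left_mono) auto
  qed
  also have "\<dots> = integral {0..b} (\<lambda>t. \<Sum>e\<in>edges G. escale G e * (p * t powr (p - 1) * cut_weight G e (superlevel z t)))"
    by (simp only: boundary_vol_def sum_distrib_left mult.left_commute)
  also have "\<dots> = (\<Sum>e\<in>edges G. escale G e * J e)"
    unfolding J_def by (subst integral_sum) (auto intro!: integrable_on_mult_right int)
  also have "\<dots> \<le> (\<Sum>e\<in>edges G. escale G e * (p * R e powr (p - 1) * lovasz_ext G e z))"
    using R(2) escale_pos by (intro sum_mono mult_left_mono) (auto simp: less_imp_le)
  also have "\<dots> = p * (\<Sum>e\<in>edges G. escale G e * (lovasz_ext G e z * R e powr (p - 1)))"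
    by (simp only: sum_distrib_left mult.assoc mult.left_commute mult.commute)
  also have "\<dots> \<le> p * ((\<Sum>e\<in>edges G. escale G e * lovasz_ext G e z powr p) powr (1 / p)
      * (\<Sum>e\<in>edges G. escale G e * R e powr p) powr ((p - 1) / p))"
    using p R(1) escale_pos lovasz_ext_nonneg
    by (intro mult_left_mono weighted_Hoelder) (auto simp: less_imp_le)
  also have "\<dots> \<le> p * ((l * N) powr (1 / p) * (\<kappa> * max_degree_ratio G * N) powr ((p - 1) / p))"
  proof (intro mult_left_mono mult_mono powr_mono2)
    show "(\<Sum>e\<in>edges G. escale G e * lovasz_ext G e z powr p) \<le> l * N"
      using energy by (simp add: energy_def N_def)
    have "(\<Sum>e\<in>edges G. escale G e * R e powr p) \<le> (\<Sum>e\<in>edges G. escale G e * (\<kappa> * (\<Sum>v\<in>e. z $ v powr p)))"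
      using R(3) escale_pos by (intro sum_mono mult_left_mono) (auto simp: less_imp_le)
    also have "\<dots> = \<kappa> * (\<Sum>e\<in>edges G. \<Sum>v\<in>UNIV. if v \<in> e then escale G e * z $ v powr p else 0)"
      by (simp add: sum_distrib_left sum.If_cases mult.left_commute)
    \<comment> \<open>After the exchange each vertex counts with its degree, which is at most \<tau>
      times its weight.\<close>
    also have "\<dots> = \<kappa> * (\<Sum>v\<in>UNIV. \<Sum>e\<in>edges G. if v \<in> e then escale G e * z $ v powr p else 0)"
      by (subst sum.swap) simp
    also have "\<dots> = \<kappa> * (\<Sum>v\<in>UNIV. Defs.degree G v * z $ v powr p)"
    proof -
      have "(\<Sum>e\<in>edges G. if v \<in> e then escale G e * z $ v powr p else 0) = Defs.degree G v * z $ v powr p" for v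
        by (simp add: Defs.degree_def sum_distrib_right flip: sum.inter_filter)
      then show ?thesis by simp
    qed
    also have "\<dots> \<le> \<kappa> * (\<Sum>v\<in>UNIV. max_degree_ratio G * vweight G v * z $ v powr p)"
      using \<kappa> by (intro mult_left_mono sum_mono mult_right_mono degree_ratio_le) auto
    also have "\<dots> = \<kappa> * max_degree_ratio G * N"
      by (simp only: N_def sum_distrib_left mult.assoc)
    finally show "(\<Sum>e\<in>edges G. escale G e * R e powr p) \<le> \<kappa> * max_degree_ratio G * N" .
    show "0 \<le> (\<Sum>e\<in>edges G. escale G e * lovasz_ext G e z powr p)"
      "0 \<le> (\<Sum>e\<in>edges G. escale G e * R e powr p)"
      using escale_pos by (auto intro!: sum_nonneg simp: less_imp_le)
  qed (use p in auto)
  also have "\<dots> = p * (l powr (1 / p) * (\<kappa> * max_degree_ratio G) powr ((p - 1) / p)) * (N powr (1 / p) * N powr ((p - 1) / p))"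
    using l \<kappa> N max_degree_ratio_pos by (simp add: powr_mult mult_ac)
  also have "N powr (1 / p) * N powr ((p - 1) / p) = N"
    using N p by (simp add: powr_add [symmetric] add_divide_distrib [symmetric])
  finally have "h \<le> p * (l powr (1 / p) * (\<kappa> * max_degree_ratio G) powr ((p - 1) / p))"
    using N by simp
  moreover have "boundary_vol G S = h * vol G S"
    using S vol_pos [of S] by (simp add: P_def)
  ultimately have "boundary_vol G S \<le> p * (l powr (1 / p) * (\<kappa> * max_degree_ratio G) powr ((p - 1) / p)) * vol G S"
    using vol_nonneg [of S] by (simp add: mult_right_mono)
  then show thesis
    using S(1) by (intro that [of S]) (auto simp: P_def)
qed

end

text \<open>Hoelder's inequality against the constant 1; the cardinality is the source of the
  constants in the upper bounds.\<close>

lemma powr_sum_le: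
  fixes p :: real
  assumes "finite J" "p \<ge> 1" "\<And>i. i \<in> J \<Longrightarrow> 0 \<le> b i"
  shows "(\<Sum>i\<in>J. b i) powr p \<le> real (card J) powr (p - 1) * (\<Sum>i\<in>J. b i powr p)"
proof -
  have "(\<Sum>i\<in>J. b i) \<le> (\<Sum>i\<in>J. b i powr p) powr (1 / p) * real (card J) powr ((p - 1) / p)"
    using weighted_Hoelder [of J p "\<lambda>_. 1" b "\<lambda>_. 1"] assms by simp
  then have "(\<Sum>i\<in>J. b i) powr p \<le> ((\<Sum>i\<in>J. b i powr p) powr (1 / p) * real (card J) powr ((p - 1) / p)) powr p"
    using assms by (intro powr_mono2 sum_nonneg) auto
  also have "\<dots> = (\<Sum>i\<in>J. b i powr p) * real (card J) powr (p - 1)"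
    using assms by (simp add: powr_mult powr_powr sum_nonneg)
  finally show ?thesis by (simp add: mult.commute)
qed

text \<open>The minimum is taken over e without u, which keeps the two vertices distinct even if f
  is constant on e.\<close>

lemma extremal_pair:
  fixes f :: "'a \<Rightarrow> real"
  assumes "2 \<le> card e"
  obtains u u' where "u \<in> e" "u' \<in> e" "u \<noteq> u'" "\<And>v. v \<in> e \<Longrightarrow> f u' \<le> f v \<and> f v \<le> f u"
proof -
  have fin: "finite e" using assms by (metis card.infinite not_numeral_le_zero)
  have ne: "e \<noteq> {}" using assms by auto
  have "Max (f ` e) \<in> f ` e" using fin ne by (intro Max_in) auto
  then obtain u where u: "u \<in> e" "Max (f ` e) = f u" by auto
  have max: "f v \<le> f u" if "v \<in> e" for v
    unfolding u(2) [symmetric] using that fin by (intro Max_ge) auto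
  have "card (e - {u}) \<noteq> 0" using assms u(1) fin by simp
  then have "e - {u} \<noteq> {}" using card.empty by fastforce
  then have "Min (f ` (e - {u})) \<in> f ` (e - {u})" using fin by (intro Min_in) auto
  then obtain u' where u': "u' \<in> e - {u}" "Min (f ` (e - {u})) = f u'" by auto
  have min: "f u' \<le> f v" if "v \<in> e - {u}" for v
    unfolding u'(2) [symmetric] using that fin by (intro Min_le) auto
  show thesis
  proof (rule that [of u u'])
    fix v assume "v \<in> e"
    then show "f u' \<le> f v \<and> f v \<le> f u"
      using u' max [of v] max [of u'] min [of v] by (cases "v = u") auto
  qed (use u u' in auto)
qed

section \<open>From cuts in the nodal domains to the lower bound\<close>

context submodular_hg
begin

text \<open>That l is nonnegative falls out of the restricted energy inequality, since the energy is
  nonnegative and the weighted sum of p-th powers positive; the estimates with roots of l rely on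
  it.\<close>

lemma nodal_cut:
  assumes p: "p \<ge> 1" and \<kappa>: "\<kappa> \<ge> 0"
    and y: "\<And>e. e \<in> edges G \<Longrightarrow> y e \<in> base_polytope G e \<and> y e \<bullet> x = lovasz_ext G e x"
    and eq: "\<And>v. (\<Sum>e\<in>edges G. escale G e * (if p = 1 then 1 else lovasz_ext G e x powr (p - 1)) * y e $ v)
      = l * (vweight G v * z $ v)"
    and z: "\<And>v. z $ v * x $ v = \<bar>x $ v\<bar> powr p"
    and A: "A \<in> adj_components G {v. x $ v > 0}"
    and local: "\<And>e b z. \<lbrakk>e \<in> edges G; \<And>v. 0 \<le> z $ v \<and> z $ v \<le> b\<rbrakk> \<Longrightarrow>
      \<exists>R\<ge>0. integral {0..b} (\<lambda>t. p * t powr (p - 1) * cut_weight G e (superlevel z t))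
            \<le> p * R powr (p - 1) * lovasz_ext G e z \<and> R powr p \<le> \<kappa> * (\<Sum>v\<in>e. z $ v powr p)"
  shows "0 \<le> l" and "\<exists>S. S \<noteq> {} \<and> S \<subseteq> A \<and>
    boundary_vol G S \<le> p * (l powr (1 / p) * (\<kappa> * max_degree_ratio G) powr ((p - 1) / p)) * vol G S"
proof -
  define xA where "xA = (\<chi> v. if v \<in> A then x $ v else 0)"
  have en: "energy G p xA \<le> l * (\<Sum>v\<in>UNIV. vweight G v * xA $ v powr p)"
    unfolding xA_def by (rule energy_restrict_le [OF p y eq z adj_components(2) [OF A] adj_components(3) [OF A]])
  have xA: "v \<in> A \<Longrightarrow> xA $ v > 0" "v \<notin> A \<Longrightarrow> xA $ v = 0" for v
    using adj_components(2) [OF A] by (auto simp: xA_def)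
  have "0 \<le> energy G p xA"
    by (rule energy_nonneg)
  moreover have "0 < (\<Sum>v\<in>UNIV. vweight G v * xA $ v powr p)"
  proof -
    obtain v where "v \<in> A" using adj_components(1) [OF A] by blast
    then have "xA $ v > 0" by (rule xA)
    then have "0 < vweight G v * xA $ v powr p"
      using vweight_pos [of v] by simp
    moreover have "0 \<le> vweight G u * xA $ u powr p" for u
      using vweight_pos [of u] by simp
    ultimately show ?thesis
      by (intro sum_pos2 [of _ v]) simp_all
  qed
  ultimately show l: "0 \<le> l"
    using en by (smt (verit) mult_neg_pos)
  show "\<exists>S. S \<noteq> {} \<and> S \<subseteq> A \<and>
    boundary_vol G S \<le> p * (l powr (1 / p) * (\<kappa> * max_degree_ratio G) powr ((p - 1) / p)) * vol G S"
    by (rule sweep_cut [OF p l \<kappa> adj_components(1) [OF A] xA(1) xA(2) en local]) auto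
qed

lemma eigenvalue_lower_bound:
  assumes p: "p \<ge> 1" and \<kappa>: "\<kappa> > 0" and eig: "eigenpair G p l x"
    and local: "\<And>e b z. \<lbrakk>e \<in> edges G; \<And>v. 0 \<le> z $ v \<and> z $ v \<le> b\<rbrakk> \<Longrightarrow>
      \<exists>R\<ge>0. integral {0..b} (\<lambda>t. p * t powr (p - 1) * cut_weight G e (superlevel z t))
            \<le> p * R powr (p - 1) * lovasz_ext G e z \<and> R powr p \<le> \<kappa> * (\<Sum>v\<in>e. z $ v powr p)"
  shows "(1 / (\<kappa> * max_degree_ratio G)) powr (p - 1) * (cheeger_const G (card (strong_nodal_domains G x)) / p) powr p \<le> l"
proof -
  define H where "H = p * (l powr (1 / p) * (\<kappa> * max_degree_ratio G) powr ((p - 1) / p))"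
  define D where "D = strong_nodal_domains G x"
  obtain y z where yz: "\<And>e. e \<in> edges G \<Longrightarrow> y e \<in> base_polytope G e \<and> y e \<bullet> x = lovasz_ext G e x"
    "\<And>v. (\<Sum>e\<in>edges G. escale G e * (if p = 1 then 1 else lovasz_ext G e x powr (p - 1)) * y e $ v)
      = l * (vweight G v * z $ v)"
    "\<And>v. z $ v * x $ v = \<bar>x $ v\<bar> powr p"
    by (rule eigenpair_cases [OF eig p]) (rule that)
  \<comment> \<open>Negative nodal domains of x are positive ones of - x, which satisfies the same
    equation with - y and - z.\<close>
  have lov: "lovasz_ext G e (- x) = lovasz_ext G e x" if "e \<in> edges G" for e
    by (simp add: lovasz_ext_eq that symmetric_submodular.lovasz_uminus [OF symmetric_submodular_cut_weight])
  have y': "- y e \<in> base_polytope G e \<and> - y e \<bullet> (- x) = lovasz_ext G e (- x)" if e: "e \<in> edges G" for e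
    using yz(1) [OF e] symmetric_submodular.base_uminus [OF symmetric_submodular_cut_weight [OF e]]
    by (simp add: lov [OF e] base_polytope_eq [OF e])
  have eq': "(\<Sum>e\<in>edges G. escale G e * (if p = 1 then 1 else lovasz_ext G e (- x) powr (p - 1)) * (- y e) $ v)
      = l * (vweight G v * (- z) $ v)" for v
    using yz(2) [of v] by (simp add: lov sum_negf cong: if_cong)
  have z': "(- z) $ v * (- x) $ v = \<bar>(- x) $ v\<bar> powr p" for v
    using yz(3) [of v] by simp
  have cut: "0 \<le> l \<and> (\<exists>S. S \<noteq> {} \<and> S \<subseteq> A \<and> boundary_vol G S \<le> H * vol G S)" if A: "A \<in> D" for A
  proof (cases "A \<in> adj_components G {v. x $ v > 0}")
    case True
    show ?thesis
      unfolding H_def using \<kappa> by (intro conjI nodal_cut [OF p _ yz True local]) auto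
  next
    case False
    then have A': "A \<in> adj_components G {v. (- x) $ v > 0}"
      using A by (simp add: D_def strong_nodal_domains_def)
    show ?thesis
      unfolding H_def using \<kappa> by (intro conjI nodal_cut [OF p _ y' eq' z' A' local]) auto
  qed
  have D: "D \<noteq> {}" "disjoint D"
    using eig by (auto simp: D_def eigenpair_def strong_nodal_domains_nonempty disjoint_strong_nodal_domains)
  then have l: "0 \<le> l" using cut by blast
  obtain S where S: "\<And>A. A \<in> D \<Longrightarrow> S A \<noteq> {} \<and> S A \<subseteq> A \<and> boundary_vol G (S A) \<le> H * vol G (S A)"
    using cut by metis
  have disS: "S A \<inter> S B = {}" if "A \<in> D" "B \<in> D" "A \<noteq> B" for A B
    using S [OF that(1)] S [OF that(2)] disjointD [OF D(2) that] by blast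
  \<comment> \<open>The selected sets are nonempty and disjoint, hence there are as many as nodal
    domains.\<close>
  have "inj_on S D"
    using disS S by (intro inj_onI) (metis Int_absorb)
  then have card: "card (S ` D) = card D"
    by (rule card_image)
  have SD: "disjoint (S ` D)"
    using disS by (intro disjointI) auto
  have "cheeger_const G (card (S ` D)) \<le> H"
    using D S SD by (intro cheeger_const_le) auto
  then have le: "cheeger_const G (card D) \<le> H" by (simp only: card)
  have "0 \<le> cheeger_const G (card (S ` D))"
    using D S SD by (intro cheeger_const_nonneg) auto
  then have nonneg: "0 \<le> cheeger_const G (card D)" by (simp only: card)
  define T where "T = \<kappa> * max_degree_ratio G"
  have T: "T > 0" using \<kappa> max_degree_ratio_pos by (simp add: T_def)
  have "cheeger_const G (card D) / p \<le> l powr (1 / p) * T powr ((p - 1) / p)"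
    using le p by (simp add: H_def pos_divide_le_eq mult.commute flip: T_def)
  then have "(cheeger_const G (card D) / p) powr p \<le> (l powr (1 / p) * T powr ((p - 1) / p)) powr p"
    using nonneg p by (intro powr_mono2) auto
  also have "\<dots> = l * T powr (p - 1)"
    using l p T by (simp add: powr_mult powr_powr)
  finally have "(1 / T) powr (p - 1) * (cheeger_const G (card D) / p) powr p \<le> (1 / T) powr (p - 1) * (l * T powr (p - 1))"
    by (intro mult_left_mono) auto
  also have "\<dots> = l * ((1 / T) * T) powr (p - 1)"
    using T by (simp only: powr_mult) simp
  also have "(1 / T) * T = 1" using T by simp
  finally show ?thesis by (simp add: D_def T_def)
qed

text \<open>R is the maximum of z on e, and its p-th power is a single term of the sum.\<close>

lemma power_integral_le_edge:
  assumes p: "p \<ge> 1" and e: "e \<in> edges G" and z: "\<And>v. 0 \<le> z $ v \<and> z $ v \<le> b"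
  shows "\<exists>R\<ge>0. integral {0..b} (\<lambda>t. p * t powr (p - 1) * cut_weight G e (superlevel z t))
            \<le> p * R powr (p - 1) * lovasz_ext G e z \<and> R powr p \<le> 1 * (\<Sum>v\<in>e. z $ v powr p)"
proof -
  interpret symmetric_submodular "cut_weight G e"
    by (rule symmetric_submodular_cut_weight [OF e])
  obtain u u' where u: "u \<in> e" "u' \<in> e" "u \<noteq> u'" "\<And>v. v \<in> e \<Longrightarrow> z $ u' \<le> z $ v \<and> z $ v \<le> z $ u"
    by (rule extremal_pair [OF two_le_card_edge [OF e], of "\<lambda>v. z $ v"]) (rule that)
  have "integral {0..b} (\<lambda>t. p * t powr (p - 1) * cut_weight G e (superlevel z t)) \<le> p * (z $ u) powr (p - 1) * lovasz z"
    using u by (intro power_integral_le [OF p z cut_weight_local]) auto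
  moreover have "z $ u powr p \<le> (\<Sum>v\<in>e. z $ v powr p)"
    using u(1) by (intro member_le_sum) auto
  ultimately show ?thesis
    using z [of u] by (intro exI [of _ "z $ u"]) (simp add: lovasz_ext_eq [OF e])
qed

lemma homogeneous_cut_weight:
  assumes hom: "homogeneous G" and e: "e \<in> edges G"
  shows "cut_weight G e S = (if S \<inter> e = {} \<or> e \<subseteq> S then 0 else 1)"
proof (cases "S \<inter> e = {} \<or> e \<subseteq> S")
  case True
  then have "S \<inter> e = {} \<or> S \<inter> e = e" by blast
  then show ?thesis
    using True eweight_empty [OF e] eweight_diff [OF e, of "{}"] by (auto simp: cut_weight_def)
next
  case False
  then have "S \<inter> e \<in> Pow e - {{}, e}" by blast
  then show ?thesis
    using False hom e by (simp add: cut_weight_def homogeneous_def)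
qed

text \<open>R is the p-th power mean of the maximum and minimum of z on e. They are taken at two
  distinct vertices, so both occur in the sum, and this gives the factor 1/2.\<close>

lemma power_integral_le_edge_homogeneous:
  assumes p: "p \<ge> 1" and hom: "homogeneous G" and e: "e \<in> edges G" and z: "\<And>v. 0 \<le> z $ v \<and> z $ v \<le> b"
  shows "\<exists>R\<ge>0. integral {0..b} (\<lambda>t. p * t powr (p - 1) * cut_weight G e (superlevel z t))
            \<le> p * R powr (p - 1) * lovasz_ext G e z \<and> R powr p \<le> 1 / 2 * (\<Sum>v\<in>e. z $ v powr p)"
proof -
  interpret symmetric_submodular "cut_weight G e"
    by (rule symmetric_submodular_cut_weight [OF e])
  obtain u u' where u: "u \<in> e" "u' \<in> e" "u \<noteq> u'" "\<And>v. v \<in> e \<Longrightarrow> z $ u' \<le> z $ v \<and> z $ v \<le> z $ u"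
    by (rule extremal_pair [OF two_le_card_edge [OF e], of "\<lambda>v. z $ v"]) (rule that)
  define R where "R = ((z $ u powr p + z $ u' powr p) / 2) powr (1 / p)"
  have "integral {0..b} (\<lambda>t. p * t powr (p - 1) * cut_weight G e (superlevel z t)) \<le> p * R powr (p - 1) * lovasz z"
    unfolding R_def
    by (rule full_cut_power_integral_le [OF homogeneous_cut_weight [OF hom e] p z u(1,2,4)])
  moreover have "R powr p \<le> 1 / 2 * (\<Sum>v\<in>e. z $ v powr p)"
  proof -
    have "R powr p = 1 / 2 * (\<Sum>v\<in>{u, u'}. z $ v powr p)"
      using p u(3) by (simp add: R_def powr_powr)
    also have "\<dots> \<le> 1 / 2 * (\<Sum>v\<in>e. z $ v powr p)"
      using u by (intro mult_left_mono sum_mono2) auto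
    finally show ?thesis .
  qed
  ultimately show ?thesis
    by (intro exI [of _ R]) (simp add: lovasz_ext_eq [OF e] R_def)
qed

end


section \<open>The upper bound\<close>

text \<open>Coefficients are functions on \<open>nat\<close>, so that points of
  \<open>nsphere (k - 1)\<close> can be inserted directly.\<close>

definition tuple_vector :: "nat \<Rightarrow> 'n::finite set list \<Rightarrow> (nat \<Rightarrow> real) \<Rightarrow> real ^ 'n" where
  "tuple_vector k Ss a = (\<chi> v. \<Sum>i<k. if v \<in> Ss ! i then a i else 0)"

lemma tuple_vector_in:
  assumes Ss: "Ss \<in> disjoint_tuples k" and i: "i < k" and v: "v \<in> Ss ! i"
  shows "tuple_vector k Ss a $ v = a i"
proof -
  have "v \<notin> Ss ! j" if "j < k" "j \<noteq> i" for j
    using Ss i v that by (auto simp: disjoint_tuples_def)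
  then have "(\<Sum>j<k. if v \<in> Ss ! j then a j else 0) = (\<Sum>j<k. if j = i then a j else 0)"
    using v by (intro sum.cong) auto
  then show ?thesis using i by (simp add: tuple_vector_def)
qed

lemma tuple_vector_out:
  assumes "\<And>i. i < k \<Longrightarrow> v \<notin> Ss ! i"
  shows "tuple_vector k Ss a $ v = 0"
  using assms by (simp add: tuple_vector_def)

text \<open>Disjointness leaves at most one coefficient at each vertex, so an entrywise function
  fixing 0 acts on the coefficients.\<close>

lemma abs_tuple_vector_powr:
  assumes Ss: "Ss \<in> disjoint_tuples k"
  shows "\<bar>tuple_vector k Ss a $ v\<bar> powr p = tuple_vector k Ss (\<lambda>i. \<bar>a i\<bar> powr p) $ v"
proof (cases "\<exists>i<k. v \<in> Ss ! i")
  case True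
  then show ?thesis using tuple_vector_in [OF Ss] by auto
next
  case False
  then show ?thesis by (simp add: tuple_vector_out)
qed

lemma sum_tuple_vector:
  "(\<Sum>v\<in>UNIV. \<mu> v * tuple_vector k Ss a $ v) = (\<Sum>i<k. a i * (\<Sum>v\<in>Ss ! i. \<mu> v))"
proof -
  have "(\<Sum>v\<in>UNIV. \<mu> v * tuple_vector k Ss a $ v) = (\<Sum>v\<in>UNIV. \<Sum>i<k. if v \<in> Ss ! i then a i * \<mu> v else 0)"
    by (auto simp: tuple_vector_def sum_distrib_left intro!: sum.cong)
  also have "\<dots> = (\<Sum>i<k. \<Sum>v\<in>UNIV. if v \<in> Ss ! i then a i * \<mu> v else 0)"
    by (rule sum.swap)
  also have "\<dots> = (\<Sum>i<k. a i * (\<Sum>v\<in>Ss ! i. \<mu> v))"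
    by (simp add: sum.If_cases sum_distrib_left)
  finally show ?thesis .
qed

lemma tuple_vector_add: "tuple_vector k Ss a + tuple_vector k Ss b = tuple_vector k Ss (\<lambda>i. a i + b i)"
  by (auto simp: tuple_vector_def vec_eq_iff simp flip: sum.distrib intro!: sum.cong)

lemma tuple_vector_scaleR: "c *\<^sub>R tuple_vector k Ss a = tuple_vector k Ss (\<lambda>i. c * a i)"
  by (auto simp: tuple_vector_def vec_eq_iff sum_distrib_left intro!: sum.cong)

lemma tuple_vector_uminus: "tuple_vector k Ss (\<lambda>i. - a i) = - tuple_vector k Ss a"
  using tuple_vector_scaleR [of "-1" k Ss a] by simp

lemma closed_range_tuple_vector: "closed (range (tuple_vector k Ss))"
proof (rule closed_subspace)
  show "subspace (range (tuple_vector k Ss))"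
    unfolding subspace_def
  proof (intro conjI ballI allI)
    have "tuple_vector k Ss (\<lambda>i. 0) = 0"
      by (simp add: tuple_vector_def vec_eq_iff)
    then show "0 \<in> range (tuple_vector k Ss)" by (metis rangeI)
  qed (auto simp: tuple_vector_add tuple_vector_scaleR)
qed

lemma continuous_on_abs_powr_sum:
  fixes \<mu> :: "'n::finite \<Rightarrow> real"
  assumes "p \<ge> 1"
  shows "continuous_on S (\<lambda>x::real^'n. \<Sum>v\<in>UNIV. \<mu> v * \<bar>x $ v\<bar> powr p)"
  using assms by (intro continuous_on_sum continuous_on_mult continuous_on_powr' continuous_intros) auto

context submodular_hg
begin

lemma closed_p_sphere:
  assumes "p \<ge> 1"
  shows "closed (p_sphere G p)"
  unfolding p_sphere_def
  by (intro closed_Collect_eq continuous_on_abs_powr_sum assms continuous_on_const)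

lemma p_sphere_tuple_vector:
  assumes "Ss \<in> disjoint_tuples k"
  shows "(\<Sum>v\<in>UNIV. vweight G v * \<bar>tuple_vector k Ss a $ v\<bar> powr p) = (\<Sum>i<k. \<bar>a i\<bar> powr p * vol G (Ss ! i))"
  unfolding abs_tuple_vector_powr [OF assms] sum_tuple_vector vol_def ..

text \<open>The map g rescales \<open>tuple_vector\<close> to the p-sphere and is an odd continuous
  map from the unit sphere of k-space into A. An odd map from A to punctured j-space with j < k
  would compose with g to contradict Borsuk-Ulam.\<close>

lemma genus_tuple_sphere:
  assumes Ss: "Ss \<in> disjoint_tuples k" and k: "1 \<le> k" "k \<le> CARD('n)" and p: "p \<ge> 1"
  shows "range (tuple_vector k Ss) \<inter> p_sphere G p \<in> genus_sets G p k"
    and "range (tuple_vector k Ss) \<inter> p_sphere G p \<noteq> {}"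
proof -
  define A where "A = range (tuple_vector k Ss) \<inter> p_sphere G p"
  define N where "N = (\<lambda>x. \<Sum>v\<in>UNIV. vweight G v * \<bar>x $ v\<bar> powr p)"
  define g where "g = (\<lambda>a. (1 / N (tuple_vector k Ss a) powr (1 / p)) *\<^sub>R tuple_vector k Ss a)"
  let ?X = "topspace (nsphere (k - 1))"
  have Npos: "N (tuple_vector k Ss a) > 0" if a: "a \<in> ?X" for a
  proof -
    have "(\<Sum>i\<le>k - 1. (a i)\<^sup>2) = 1" using a by (simp add: nsphere)
    then obtain i where i: "i \<le> k - 1" "a i \<noteq> 0"
      by (metis (no_types, lifting) atMost_iff power_zero_numeral sum.neutral zero_neq_one)
    then have "i < k" using k by simp
    have "vol G (Ss ! i) > 0"
      using Ss \<open>i < k\<close> by (intro vol_pos) (simp add: disjoint_tuples_def)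
    then have "0 < \<bar>a i\<bar> powr p * vol G (Ss ! i)" using i by simp
    moreover have "0 \<le> \<bar>a j\<bar> powr p * vol G (Ss ! j)" for j
      using vol_nonneg by simp
    ultimately show ?thesis
      unfolding N_def p_sphere_tuple_vector [OF Ss] using \<open>i < k\<close>
      by (intro sum_pos2 [of _ i]) simp_all
  qed
  have Nscale: "N (c *\<^sub>R x) = \<bar>c\<bar> powr p * N x" for c x
    by (simp add: N_def abs_mult powr_mult sum_distrib_left mult.left_commute)
  have gA: "g a \<in> A" if a: "a \<in> ?X" for a
  proof -
    have "N (g a) = 1"
      using Npos [OF a] p by (simp add: g_def Nscale powr_divide powr_powr)
    moreover have "g a \<in> range (tuple_vector k Ss)"
      by (simp add: g_def tuple_vector_scaleR)
    ultimately show ?thesis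
      by (simp add: A_def p_sphere_def N_def)
  qed
  have godd: "g (\<lambda>i. - a i) = - g a" for a
    by (simp add: g_def tuple_vector_uminus N_def)
  have cont_tv: "continuous_on ?X (tuple_vector k Ss)"
  proof -
    have "continuous_on ?X (\<lambda>a. if v \<in> Ss ! i then a i else 0)" for v i
      by (cases "v \<in> Ss ! i") (auto intro: continuous_on_subset [OF continuous_on_product_coordinates])
    then show ?thesis
      unfolding tuple_vector_def by (intro continuous_on_vec_lambda continuous_on_sum)
  qed
  have "continuous_on ?X (\<lambda>a. N (tuple_vector k Ss a))"
    unfolding N_def
    by (rule continuous_on_compose2 [OF continuous_on_abs_powr_sum [OF p] cont_tv subset_UNIV])
  then have "continuous_on ?X g"
    unfolding g_def using Npos p
    by (intro continuous_on_scaleR continuous_on_divide continuous_on_const continuous_on_powr' cont_tv)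
      (force simp: less_imp_le)+
  then have "continuous_map (top_of_set ?X) (top_of_set A) g"
    using gA by (auto simp: continuous_map_in_subtopology)
  \<comment> \<open>Identifies the abstract topology with a subspace of
    \<open>nat \<Rightarrow> real\<close>, where the \<open>continuous_on\<close> rules
    apply.\<close>
  moreover have "nsphere (k - 1) = top_of_set ?X"
    by (simp add: nsphere euclidean_product_topology)
  ultimately have gc: "continuous_map (nsphere (k - 1)) (top_of_set A) g"
    by metis
  have "A \<noteq> {}"
    using gA [OF in_topspace_nsphere] by blast
  then show "range (tuple_vector k Ss) \<inter> p_sphere G p \<noteq> {}" unfolding A_def .
  have "k \<le> j" if j: "j > 0" "odd_map_exists A j" for j
  proof (rule ccontr)
    assume "\<not> k \<le> j"
    \<comment> \<open>The sphere in k-space has dimension k - 1, so j < k is the range covered by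
      Borsuk-Ulam.\<close>
    then have jk: "j \<le> k - 1" "Suc (k - 1) \<le> CARD('n)" using k by auto
    obtain f where f: "continuous_map (top_of_set A)
            (subtopology (Euclidean_space j) (topspace (Euclidean_space j) - {\<lambda>i. 0})) f"
      and fodd: "\<And>x. x \<in> A \<Longrightarrow> f (- x) = - f x"
      using j(2) unfolding odd_map_exists_def by blast
    obtain a where a: "a \<in> ?X" "(f \<circ> g) (\<lambda>i. - a i) \<noteq> (\<lambda>i. - (f \<circ> g) a i)"
      using Borsuk_Ulam_nsphere [OF jk(2,1) continuous_map_compose [OF gc f]] by blast
    have "(f \<circ> g) (\<lambda>i. - a i) = - f (g a)"
      by (simp add: godd fodd [OF gA [OF a(1)]])
    then show False using a(2) by (simp add: fun_Compl_def)
  qed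
  then have "enat k \<le> genus A"
    unfolding genus_def using \<open>A \<noteq> {}\<close> by (auto intro!: Inf_greatest)
  moreover have "A = uminus ` A"
  proof -
    have neg: "- x \<in> A" if x: "x \<in> A" for x
    proof -
      obtain a where "x = tuple_vector k Ss a" using x by (auto simp: A_def)
      then have "- x \<in> range (tuple_vector k Ss)" by (simp flip: tuple_vector_uminus)
      then show ?thesis using x by (simp add: A_def p_sphere_def)
    qed
    then have "A \<subseteq> uminus ` A"
      by (intro subsetI image_eqI [of _ uminus "- _"]) simp_all
    with neg show ?thesis by auto
  qed
  moreover have "closed A"
    unfolding A_def by (intro closed_Int closed_range_tuple_vector closed_p_sphere p)
  ultimately show "range (tuple_vector k Ss) \<inter> p_sphere G p \<in> genus_sets G p k"
    by (simp add: genus_sets_def A_def)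
qed

text \<open>Makes the suprema over genus sets meaningful: the p-sphere bounds every entry, and the
  1-norm bounds each f_e since the weights are at most 1.\<close>

lemma bdd_above_energy:
  assumes p: "p \<ge> 1"
  shows "bdd_above (energy G p ` p_sphere G p)"
proof (rule bdd_aboveI2)
  fix x assume x: "x \<in> p_sphere G p"
  have xv: "\<bar>x $ v\<bar> \<le> (1 / vweight G v) powr (1 / p)" for v
  proof -
    have "vweight G v * \<bar>x $ v\<bar> powr p \<le> (\<Sum>v\<in>UNIV. vweight G v * \<bar>x $ v\<bar> powr p)"
      using vweight_pos by (intro member_le_sum) (auto simp: less_imp_le)
    also have "\<dots> = 1" using x by (simp add: p_sphere_def)
    finally have "\<bar>x $ v\<bar> powr p \<le> 1 / vweight G v"
      using vweight_pos [of v] by (simp add: pos_le_divide_eq mult.commute)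
    then have "(\<bar>x $ v\<bar> powr p) powr (1 / p) \<le> (1 / vweight G v) powr (1 / p)"
      using p by (intro powr_mono2) auto
    then show ?thesis using p by (simp add: powr_powr)
  qed
  show "energy G p x \<le> (\<Sum>e\<in>edges G. escale G e * (\<Sum>v\<in>UNIV. (1 / vweight G v) powr (1 / p)) powr p)"
    unfolding energy_def
  proof (intro sum_mono mult_left_mono powr_mono2)
    fix e assume e: "e \<in> edges G"
    have "lovasz_ext G e x \<le> (\<Sum>v\<in>UNIV. \<bar>x $ v\<bar>)"
      unfolding lovasz_ext_eq [OF e]
      by (rule symmetric_submodular.lovasz_le_norm1 [OF symmetric_submodular_cut_weight [OF e] cut_weight_le_1 [OF e]])
    also have "\<dots> \<le> (\<Sum>v\<in>UNIV. (1 / vweight G v) powr (1 / p))"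
      by (intro sum_mono xv)
    finally show "lovasz_ext G e x \<le> (\<Sum>v\<in>UNIV. (1 / vweight G v) powr (1 / p))" .
    show "0 \<le> lovasz_ext G e x" by (rule lovasz_ext_nonneg [OF e])
    show "0 \<le> escale G e" using escale_pos [OF e] by simp
  qed (use p in auto)
qed

text \<open>The infimum is bounded below by 0, because the energy is nonnegative and every genus set
  is nonempty: the empty set has genus 0 < k.\<close>

lemma var_eigenvalue_le:
  assumes A: "A \<in> genus_sets G p k" "A \<noteq> {}" and k: "1 \<le> k" and p: "p \<ge> 1"
    and le: "\<And>x. x \<in> A \<Longrightarrow> energy G p x \<le> c"
  shows "var_eigenvalue G p k \<le> c"
proof -
  have "var_eigenvalue G p k \<le> (SUP x\<in>A. energy G p x)"
    unfolding var_eigenvalue_def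
  proof (rule cINF_lower [OF _ A(1)])
    show "bdd_below ((\<lambda>A. SUP x\<in>A. energy G p x) ` genus_sets G p k)"
    proof (rule bdd_belowI2)
      fix B assume B: "B \<in> genus_sets G p k"
      then have "B \<noteq> {}"
        using k by (auto simp: genus_sets_def genus_def zero_enat_def)
      then obtain x where x: "x \<in> B" by blast
      have "bdd_above (energy G p ` B)"
        by (rule bdd_above_mono [OF bdd_above_energy [OF p]]) (use B in \<open>auto simp: genus_sets_def\<close>)
      then show "0 \<le> (SUP x\<in>B. energy G p x)"
        by (rule cSUP_upper2 [OF _ x energy_nonneg])
    qed
  qed
  also have "\<dots> \<le> c"
    using A(2) le by (rule cSUP_least)
  finally show ?thesis .
qed

text \<open>Summed over the edges, \<open>local\<close> replaces the energy by a combination of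
  boundary volumes with coefficients of total weight 1 on the p-sphere; the Cheeger ratios of an
  optimal tuple then bound it.\<close>

lemma eigenvalue_upper_bound:
  assumes p: "p \<ge> 1" and k: "1 \<le> k" "k \<le> CARD('n)"
    and local: "\<And>e Ss a. \<lbrakk>e \<in> edges G; Ss \<in> disjoint_tuples k\<rbrakk> \<Longrightarrow>
      lovasz_ext G e (tuple_vector k Ss a) powr p \<le> K powr (p - 1) * (\<Sum>i<k. \<bar>a i\<bar> powr p * cut_weight G e (Ss ! i))"
  shows "var_eigenvalue G p k \<le> K powr (p - 1) * cheeger_const G k"
proof -
  obtain Ss where Ss: "Ss \<in> disjoint_tuples k" "\<And>i. i < k \<Longrightarrow> cheeger_ratio G (Ss ! i) \<le> cheeger_const G k"
    by (rule cheeger_const_attained [OF k]) (rule that)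
  show ?thesis
  proof (rule var_eigenvalue_le [OF genus_tuple_sphere [OF Ss(1) k p] k(1) p])
    fix x assume "x \<in> range (tuple_vector k Ss) \<inter> p_sphere G p"
    then obtain a where x: "x = tuple_vector k Ss a" and "x \<in> p_sphere G p" by blast
    then have one: "(\<Sum>i<k. \<bar>a i\<bar> powr p * vol G (Ss ! i)) = 1"
      by (simp add: p_sphere_def p_sphere_tuple_vector [OF Ss(1)])
    have "energy G p x \<le> (\<Sum>e\<in>edges G. escale G e * (K powr (p - 1) * (\<Sum>i<k. \<bar>a i\<bar> powr p * cut_weight G e (Ss ! i))))"
      unfolding energy_def x using escale_pos
      by (intro sum_mono mult_left_mono local Ss(1)) (auto simp: less_imp_le)
    also have "\<dots> = (\<Sum>e\<in>edges G. \<Sum>i<k. K powr (p - 1) * (\<bar>a i\<bar> powr p * (escale G e * cut_weight G e (Ss ! i))))"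
      by (simp add: sum_distrib_left mult_ac)
    also have "\<dots> = (\<Sum>i<k. \<Sum>e\<in>edges G. K powr (p - 1) * (\<bar>a i\<bar> powr p * (escale G e * cut_weight G e (Ss ! i))))"
      by (rule sum.swap)
    also have "\<dots> = K powr (p - 1) * (\<Sum>i<k. \<bar>a i\<bar> powr p * boundary_vol G (Ss ! i))"
      by (simp add: boundary_vol_def sum_distrib_left)
    also have "\<dots> \<le> K powr (p - 1) * (\<Sum>i<k. \<bar>a i\<bar> powr p * (cheeger_const G k * vol G (Ss ! i)))"
    proof (intro mult_left_mono sum_mono)
      fix i assume "i \<in> {..<k}"
      then have i: "i < k" by simp
      then have "boundary_vol G (Ss ! i) \<le> cheeger_ratio G (Ss ! i) * vol G (Ss ! i)"
        using Ss(1) by (intro boundary_vol_le_cheeger_ratio) (simp add: disjoint_tuples_def)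
      also have "\<dots> \<le> cheeger_const G k * vol G (Ss ! i)"
        by (intro mult_right_mono Ss(2) i vol_nonneg)
      finally show "boundary_vol G (Ss ! i) \<le> cheeger_const G k * vol G (Ss ! i)" .
    qed auto
    also have "\<dots> = K powr (p - 1) * (cheeger_const G k * (\<Sum>i<k. \<bar>a i\<bar> powr p * vol G (Ss ! i)))"
      by (simp add: sum_distrib_left mult_ac)
    finally show "energy G p x \<le> K powr (p - 1) * cheeger_const G k"
      by (simp add: one)
  qed
qed

text \<open>Only the sets of the tuple that meet e contribute, and being disjoint they number at
  most |e|, and also at most k. The power of the weight is removed by w^p \<le> w, valid for weights
  between 0 and 1.\<close>

lemma lovasz_ext_tuple_vector_le:
  assumes p: "p \<ge> 1" and e: "e \<in> edges G" and Ss: "Ss \<in> disjoint_tuples k"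
  shows "lovasz_ext G e (tuple_vector k Ss a) powr p
    \<le> real (min (max_edge_size G) k) powr (p - 1) * (\<Sum>i<k. \<bar>a i\<bar> powr p * cut_weight G e (Ss ! i))"
proof -
  interpret symmetric_submodular "cut_weight G e"
    by (rule symmetric_submodular_cut_weight [OF e])
  define J where "J = {i. i < k \<and> Ss ! i \<inter> e \<noteq> {}}"
  have J: "finite J" "J \<subseteq> {..<k}" by (auto simp: J_def)
  define b where "b = (\<lambda>i. \<bar>a i\<bar> * cut_weight G e (Ss ! i))"
  have b0: "0 \<le> b i" for i by (simp add: b_def nonneg)
  have outside: "cut_weight G e (Ss ! i) = 0" if "i \<in> {..<k} - J" for i
    using that cut_weight_local [of e "Ss ! i"] by (simp add: J_def)
  have "lovasz_ext G e (tuple_vector k Ss a) \<le> (\<Sum>i<k. b i)"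
    unfolding lovasz_ext_eq [OF e] b_def
    by (rule lovasz_indicator_sum_le) (simp add: tuple_vector_def)
  also have "\<dots> = (\<Sum>i\<in>J. b i)"
    using J outside by (intro sum.mono_neutral_right) (auto simp: b_def)
  finally have "lovasz_ext G e (tuple_vector k Ss a) powr p \<le> (\<Sum>i\<in>J. b i) powr p"
    using p lovasz_ext_nonneg [OF e] by (intro powr_mono2) auto
  also have "\<dots> \<le> real (card J) powr (p - 1) * (\<Sum>i\<in>J. b i powr p)"
    by (rule powr_sum_le [OF J(1) p b0])
  also have "\<dots> \<le> real (min (max_edge_size G) k) powr (p - 1) * (\<Sum>i<k. \<bar>a i\<bar> powr p * cut_weight G e (Ss ! i))"
  proof (rule mult_mono)
    define c where "c = (\<lambda>i. SOME v. v \<in> Ss ! i \<inter> e)"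
    have c: "c i \<in> Ss ! i \<inter> e" if "i \<in> J" for i
      using that unfolding c_def some_in_eq by (simp add: J_def)
    have "inj_on c J"
    proof (rule inj_onI, rule ccontr)
      fix i j assume ij: "i \<in> J" "j \<in> J" "c i = c j" "i \<noteq> j"
      then have "Ss ! i \<inter> Ss ! j = {}"
        using Ss by (simp add: J_def disjoint_tuples_def)
      then show False using c [OF ij(1)] c [OF ij(2)] ij(3) by auto
    qed
    then have "card J \<le> card e"
      using c by (intro card_inj_on_le [of c]) auto
    also have "\<dots> \<le> max_edge_size G"
      unfolding max_edge_size_def using e by (intro Max_ge) auto
    finally have "card J \<le> max_edge_size G" .
    moreover have "card J \<le> k"
      using card_mono [OF finite_lessThan J(2)] by simp
    ultimately show "real (card J) powr (p - 1) \<le> real (min (max_edge_size G) k) powr (p - 1)"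
      using p by (intro powr_mono2) auto
    have "(\<Sum>i\<in>J. b i powr p) \<le> (\<Sum>i\<in>J. \<bar>a i\<bar> powr p * cut_weight G e (Ss ! i))"
    proof (rule sum_mono)
      fix i
      have "cut_weight G e (Ss ! i) powr p \<le> cut_weight G e (Ss ! i) powr 1"
        using p nonneg cut_weight_le_1 [OF e] by (intro powr_mono') auto
      then show "b i powr p \<le> \<bar>a i\<bar> powr p * cut_weight G e (Ss ! i)"
        using nonneg [of "Ss ! i"] by (simp add: b_def powr_mult mult_left_mono)
    qed
    also have "\<dots> = (\<Sum>i<k. \<bar>a i\<bar> powr p * cut_weight G e (Ss ! i))"
      using J outside by (intro sum.mono_neutral_left) auto
    finally show "(\<Sum>i\<in>J. b i powr p) \<le> (\<Sum>i<k. \<bar>a i\<bar> powr p * cut_weight G e (Ss ! i))" .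
  qed (auto intro: sum_nonneg)
  finally show ?thesis .
qed

text \<open>Here f_e is the difference of the extreme values on e, so only two vertices enter and
  the power sum inequality costs a factor 2^(p - 1), however many sets meet e.\<close>

lemma lovasz_ext_tuple_vector_le_homogeneous:
  assumes p: "p \<ge> 1" and hom: "homogeneous G" and e: "e \<in> edges G" and Ss: "Ss \<in> disjoint_tuples k"
  shows "lovasz_ext G e (tuple_vector k Ss a) powr p
    \<le> 2 powr (p - 1) * (\<Sum>i<k. \<bar>a i\<bar> powr p * cut_weight G e (Ss ! i))"
proof -
  interpret symmetric_submodular "cut_weight G e"
    by (rule symmetric_submodular_cut_weight [OF e])
  let ?x = "tuple_vector k Ss a"
  have rhs: "0 \<le> 2 powr (p - 1) * (\<Sum>i<k. \<bar>a i\<bar> powr p * cut_weight G e (Ss ! i))"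
    by (intro mult_nonneg_nonneg sum_nonneg nonneg) auto
  obtain u u' where u: "u \<in> e" "u' \<in> e" "u \<noteq> u'" "\<And>v. v \<in> e \<Longrightarrow> ?x $ u' \<le> ?x $ v \<and> ?x $ v \<le> ?x $ u"
    by (rule extremal_pair [OF two_le_card_edge [OF e], of "\<lambda>v. ?x $ v"]) (rule that)
  have eq: "lovasz_ext G e ?x = ?x $ u - ?x $ u'"
    unfolding lovasz_ext_eq [OF e] by (rule full_cut_lovasz [OF homogeneous_cut_weight [OF hom e] u(1,2,4)])
  show ?thesis
  proof (cases "?x $ u = ?x $ u'")
    case True
    then show ?thesis using rhs by (simp add: eq)
  next
    case False
    have "lovasz_ext G e ?x powr p \<le> (\<Sum>v\<in>{u, u'}. \<bar>?x $ v\<bar>) powr p"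
      using u p lovasz_ext_nonneg [OF e, of ?x] by (intro powr_mono2) (auto simp: eq)
    also have "\<dots> \<le> real (card {u, u'}) powr (p - 1) * (\<Sum>v\<in>{u, u'}. \<bar>?x $ v\<bar> powr p)"
      by (rule powr_sum_le) (use p in auto)
    also have "\<dots> = 2 powr (p - 1) * (\<Sum>v\<in>{u, u'}. \<Sum>i<k. if v \<in> Ss ! i then \<bar>a i\<bar> powr p else 0)"
      using u(3) unfolding abs_tuple_vector_powr [OF Ss] by (simp add: tuple_vector_def)
    also have "\<dots> = 2 powr (p - 1) * (\<Sum>i<k. \<Sum>v\<in>{u, u'}. if v \<in> Ss ! i then \<bar>a i\<bar> powr p else 0)"
      by (subst sum.swap) simp
    also have "\<dots> \<le> 2 powr (p - 1) * (\<Sum>i<k. \<bar>a i\<bar> powr p * cut_weight G e (Ss ! i))"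
    proof (intro mult_left_mono sum_mono)
      fix i assume "i \<in> {..<k}"
      then have i: "i < k" by simp
      \<comment> \<open>A set containing both vertices would give them equal values. Hence a set
        meeting the pair contains exactly one of them, so it cuts e with weight 1.\<close>
      have "\<not> (u \<in> Ss ! i \<and> u' \<in> Ss ! i)"
        using False tuple_vector_in [OF Ss i, of u a] tuple_vector_in [OF Ss i, of u' a] by auto
      then show "(\<Sum>v\<in>{u, u'}. if v \<in> Ss ! i then \<bar>a i\<bar> powr p else 0) \<le> \<bar>a i\<bar> powr p * cut_weight G e (Ss ! i)"
        using u by (auto simp: homogeneous_cut_weight [OF hom e])
    qed auto
    finally show ?thesis .
  qed
qed

end

theorem theorem3p15:
  fixes G :: "'n::finite hypergraph"
    and p :: real and k m :: nat and x :: "real ^ 'n"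
  assumes "submodular_hypergraph G"
    and "p \<ge> 1"
    and "1 \<le> k" and "k \<le> CARD('n)"
    and "eigenpair G p (var_eigenvalue G p k) x"
    and "m = card (strong_nodal_domains G x)"
  shows "(1 / max_degree_ratio G) powr (p - 1) * (cheeger_const G m / p) powr p
             \<le> var_eigenvalue G p k
         \<and> var_eigenvalue G p k
             \<le> real (min (max_edge_size G) k) powr (p - 1) * cheeger_const G k
         \<and> (homogeneous G \<longrightarrow>
              (2 / max_degree_ratio G) powr (p - 1) * (cheeger_const G m / p) powr p
                \<le> var_eigenvalue G p k
            \<and> var_eigenvalue G p k \<le> 2 powr (p - 1) * cheeger_const G k)"
proof -
  interpret submodular_hg G
    by (rule submodular_hg.intro [OF assms(1)])
  note p = assms(2) and k = assms(3,4) and eig = assms(5)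
  have "(1 / (1 * max_degree_ratio G)) powr (p - 1) * (cheeger_const G m / p) powr p \<le> var_eigenvalue G p k"
    unfolding assms(6)
    by (rule eigenvalue_lower_bound [OF p zero_less_one eig], rule power_integral_le_edge [OF p])
  moreover have "var_eigenvalue G p k \<le> real (min (max_edge_size G) k) powr (p - 1) * cheeger_const G k"
    by (rule eigenvalue_upper_bound [OF p k], rule lovasz_ext_tuple_vector_le [OF p])
  \<comment> \<open>Taking \<kappa> = 1/2 turns 1/(\<kappa> \<tau>) into 2/\<tau>.\<close>
  moreover have "(1 / (1 / 2 * max_degree_ratio G)) powr (p - 1) * (cheeger_const G m / p) powr p \<le> var_eigenvalue G p k"
    if hom: "homogeneous G"
    unfolding assms(6)
    by (rule eigenvalue_lower_bound [OF p half_gt_zero [OF zero_less_one] eig],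
        rule power_integral_le_edge_homogeneous [OF p hom])
  moreover have "var_eigenvalue G p k \<le> 2 powr (p - 1) * cheeger_const G k" if hom: "homogeneous G"
    by (rule eigenvalue_upper_bound [OF p k], rule lovasz_ext_tuple_vector_le_homogeneous [OF p hom])
  ultimately show ?thesis
    by simp
qed

end
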